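(* Let $a,b$ be positive integers, let $g=\gcd(a,b)$, and suppose that \[ (a^n+1)(b^n+1)=x^2,\qquad a<b, \] has a solution in positive integers $(n,x)$ with $n$ even. Then for such a solution the following hold. \begin{itemize} \item[(i)] If $g=1$, then $n=2$ and there exist positive integers $r,s$ such that \[ (a,b,x)=(u_r,u_s,2v_rv_s),\quad r<s,\quad \gcd(2r-1,2s-1)=1, \] where $(u_k,v_k)$ denotes the $k$-th positive integer solution of the negative Pell equation $u^2-2v^2=-1$. \item[(ii)] If $1<g<a$, then $4\nmid n$ and $g^2<a$. \item[(iii)] If $g=a$, then $4\nmid n$ and $a^2<b$. \end{itemize}
   Context: The positive integer solutions of $u^2-2v^2=-1$ are numbered in increasing order starting from $k=1$: $(u_k,v_k)$ is given by $u_k+v_k\sqrt2=(1+\sqrt2)^{2k-1}$ for $k\ge 1$, so $(u_1,v_1)=(1,1)$, $(u_2,v_2)=(7,5)$, etc. *)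

theory Defs
  imports "HOL-Number_Theory.Number_Theory"
begin

text \<open>
  The pair \<open>(u\<^sub>k, v\<^sub>k)\<close> is the one given by \<open>u\<^sub>k + v\<^sub>k \<surd>2 = (1 + \<surd>2)\<^sup>2\<^sup>k\<^sup>-\<^sup>1\<close>; it is meant for
  \<open>k \<ge> 1\<close> only (natural subtraction truncates at \<open>k = 0\<close>). The description is well defined
  by \<open>neg_pell_eq\<close> and \<open>neg_pell_eqI\<close> below, and \<open>neg_pell_strict_mono\<close>, \<open>neg_pell_enumerates\<close>
  say that for \<open>k \<ge> 1\<close> it lists the positive solutions of \<open>u\<^sup>2 - 2 v\<^sup>2 = -1\<close> in increasing order.
\<close>

definition neg_pell :: "nat \<Rightarrow> nat \<times> nat" where
  "neg_pell k = (THE p. real (fst p) + real (snd p) * sqrt 2 = (1 + sqrt 2) ^ (2 * k - 1))"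

definition pell_u :: "nat \<Rightarrow> nat" where "pell_u k = fst (neg_pell k)"
definition pell_v :: "nat \<Rightarrow> nat" where "pell_v k = snd (neg_pell k)"

lemma sq_eq_double_sq:
  fixes m n :: nat
  assumes "m\<^sup>2 = 2 * n\<^sup>2"
  shows "n = 0"
  using assms
proof (induction n arbitrary: m rule: less_induct)
  case (less n)
  show ?case
  proof (rule ccontr)
    assume n: "n \<noteq> 0"
    have "even (m\<^sup>2)" using less.prems by simp
    then obtain j where j: "m = 2 * j" by auto
    hence nj: "n\<^sup>2 = 2 * j\<^sup>2" using less.prems by (simp add: power_mult_distrib)
    have "j < n"
    proof (rule ccontr)
      assume "\<not> j < n"
      hence "n\<^sup>2 \<le> j\<^sup>2" by (simp add: power_mono)
      thus False using nj n by simp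
    qed
    from less.IH[OF this nj] have "j = 0" .
    thus False using nj n by simp
  qed
qed

lemma sqrt2_coeffs_unique:
  fixes a b c d :: nat
  assumes "real a + real b * sqrt 2 = real c + real d * sqrt 2"
  shows "a = c \<and> b = d"
proof -
  define m n where "m = nat \<bar>int a - int c\<bar>" and "n = nat \<bar>int d - int b\<bar>"
  have "(real a - real c) = (real d - real b) * sqrt 2"
    using assms by (simp add: algebra_simps)
  hence "(real a - real c)\<^sup>2 = 2 * (real d - real b)\<^sup>2"
    by (simp add: power_mult_distrib)
  moreover have "(real m)\<^sup>2 = (real a - real c)\<^sup>2" "(real n)\<^sup>2 = (real d - real b)\<^sup>2"
    unfolding m_def n_def by simp_all
  ultimately have "real (m\<^sup>2) = real (2 * n\<^sup>2)" by simp
  hence "m\<^sup>2 = 2 * n\<^sup>2" by (simp only: of_nat_eq_iff)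
  hence "n = 0" "m = 0" using sq_eq_double_sq[of m n] by auto
  thus ?thesis unfolding m_def n_def by simp
qed

lemma neg_pell_eqI:
  assumes "real u + real v * sqrt 2 = (1 + sqrt 2) ^ (2 * k - 1)"
  shows "neg_pell k = (u, v)"
  unfolding neg_pell_def
proof (rule the_equality)
  show "real (fst (u, v)) + real (snd (u, v)) * sqrt 2 = (1 + sqrt 2) ^ (2 * k - 1)"
    using assms by simp
next
  fix p :: "nat \<times> nat"
  assume "real (fst p) + real (snd p) * sqrt 2 = (1 + sqrt 2) ^ (2 * k - 1)"
  hence "fst p = u \<and> snd p = v" using assms sqrt2_coeffs_unique by metis
  thus "p = (u, v)" by (cases p) simp
qed

lemma ex_sqrt2_power: "\<exists>u v :: nat. real u + real v * sqrt 2 = (1 + sqrt 2) ^ n"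
proof (induction n)
  case 0
  show ?case by (intro exI[of _ 1] exI[of _ 0]) simp
next
  case (Suc n)
  then obtain u v :: nat where "real u + real v * sqrt 2 = (1 + sqrt 2) ^ n" by blast
  hence "(1 + sqrt 2) ^ Suc n = (1 + sqrt 2) * (real u + real v * sqrt 2)" by simp
  also have "\<dots> = real (u + 2 * v) + real (u + v) * sqrt 2" by (simp add: algebra_simps)
  finally show ?case by metis
qed

lemma neg_pell_eq: "real (pell_u k) + real (pell_v k) * sqrt 2 = (1 + sqrt 2) ^ (2 * k - 1)"
proof -
  obtain u v :: nat where "real u + real v * sqrt 2 = (1 + sqrt 2) ^ (2 * k - 1)"
    using ex_sqrt2_power by blast
  with neg_pell_eqI[OF this] show ?thesis by (simp add: pell_u_def pell_v_def)
qed

lemma neg_pell_1: "pell_u 1 = 1" "pell_v 1 = 1"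
  using neg_pell_eqI[of 1 1 1] by (simp_all add: pell_u_def pell_v_def)

lemma neg_pell_Suc:
  assumes "k \<ge> 1"
  shows "pell_u (Suc k) = 3 * pell_u k + 4 * pell_v k"
    and "pell_v (Suc k) = 2 * pell_u k + 3 * pell_v k"
proof -
  have "2 * Suc k - 1 = 2 + (2 * k - 1)" using assms by simp
  hence "(1 + sqrt 2) ^ (2 * Suc k - 1) = (1 + sqrt 2)\<^sup>2 * (1 + sqrt 2) ^ (2 * k - 1)"
    by (simp only: power_add)
  also have "\<dots> = (3 + 2 * sqrt 2) * (real (pell_u k) + real (pell_v k) * sqrt 2)"
    unfolding neg_pell_eq by (simp add: power2_eq_square algebra_simps)
  also have "\<dots> = real (3 * pell_u k + 4 * pell_v k) + real (2 * pell_u k + 3 * pell_v k) * sqrt 2"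
    by (simp add: algebra_simps)
  finally have "neg_pell (Suc k) = (3 * pell_u k + 4 * pell_v k, 2 * pell_u k + 3 * pell_v k)"
    by (intro neg_pell_eqI) simp
  thus "pell_u (Suc k) = 3 * pell_u k + 4 * pell_v k"
    and "pell_v (Suc k) = 2 * pell_u k + 3 * pell_v k"
    by (simp_all add: pell_u_def[of "Suc k"] pell_v_def[of "Suc k"])
qed

lemma neg_pell_2: "pell_u 2 = 7" "pell_v 2 = 5"
  using neg_pell_eqI[of 7 5 2]
  by (simp_all add: pell_u_def pell_v_def power3_eq_cube algebra_simps)

lemma neg_pell_solution:
  assumes "k \<ge> 1"
  shows "pell_u k > 0 \<and> pell_v k > 0 \<and> (pell_u k)\<^sup>2 + 1 = 2 * (pell_v k)\<^sup>2"
  using assms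
proof (induction k rule: nat_induct_at_least)
  case base
  show ?case using neg_pell_1 by simp
next
  case (Suc k)
  thus ?case by (simp add: neg_pell_Suc power2_eq_square algebra_simps)
qed

lemma neg_pell_strict_mono:
  assumes "1 \<le> j" "j < k"
  shows "pell_u j < pell_u k \<and> pell_v j < pell_v k"
proof -
  have "Suc j \<le> k" using assms(2) by simp
  thus ?thesis
  proof (induction k rule: dec_induct)
    case base
    show ?case using assms(1) neg_pell_solution[of j] by (simp add: neg_pell_Suc)
  next
    case (step n)
    thus ?case using assms(1) by (simp add: neg_pell_Suc)
  qed
qed

lemma neg_pell_enumerates:
  fixes u v :: nat
  shows "(u > 0 \<and> v > 0 \<and> (int u)\<^sup>2 - 2 * (int v)\<^sup>2 = -1) \<longleftrightarrow> (\<exists>k\<ge>1. u = pell_u k \<and> v = pell_v k)"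
proof
  assume "\<exists>k\<ge>1. u = pell_u k \<and> v = pell_v k"
  then obtain k where "k \<ge> 1" "u = pell_u k" "v = pell_v k" by blast
  with neg_pell_solution[of k] have p: "u > 0" "v > 0" "u\<^sup>2 + 1 = 2 * v\<^sup>2" by auto
  from p(3) have "int (u\<^sup>2 + 1) = int (2 * v\<^sup>2)" by (simp only:)
  thus "u > 0 \<and> v > 0 \<and> (int u)\<^sup>2 - 2 * (int v)\<^sup>2 = -1" using p by simp
next
  assume "u > 0 \<and> v > 0 \<and> (int u)\<^sup>2 - 2 * (int v)\<^sup>2 = -1"
  thus "\<exists>k\<ge>1. u = pell_u k \<and> v = pell_v k"
  proof (induction v arbitrary: u rule: less_induct)
    case (less v)
    hence pos: "u > 0" "v > 0" and eq: "(int u)\<^sup>2 - 2 * (int v)\<^sup>2 = -1" by auto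
    show ?case
    proof (cases "v = 1")
      case True
      with eq have "(int u)\<^sup>2 = 1" by simp
      hence "u = 1" by (simp add: power2_eq_1_iff)
      with True show ?thesis using neg_pell_1 by (intro exI[of _ 1]) simp
    next
      case False
      have "v \<noteq> 2"
      proof
        assume "v = 2"
        with eq have u7: "(int u)\<^sup>2 = 7" by simp
        show False
        proof (cases "u \<le> 2")
          case True
          hence "(int u)\<^sup>2 \<le> 2\<^sup>2" by (intro power_mono) simp_all
          with u7 show False by simp
        next
          case False
          hence "3\<^sup>2 \<le> (int u)\<^sup>2" by (intro power_mono) simp_all
          with u7 show False by simp
        qed
      qed
      with False pos have v3: "int v \<ge> 3" by simp
      have v9: "(int v)\<^sup>2 \<ge> 9" using power_mono[OF v3, of 2] by simp
      have vu: "int v < int u"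
        by (rule power_less_imp_less_base[where n = 2]) (use eq v9 in simp_all)
      have a: "4 * int v < 3 * int u"
        by (rule power_less_imp_less_base[where n = 2]) (use eq v9 in \<open>simp_all add: power_mult_distrib\<close>)
      have b: "2 * int u < 3 * int v"
        by (rule power_less_imp_less_base[where n = 2]) (use eq v9 in \<open>simp_all add: power_mult_distrib\<close>)
      define u' v' where "u' = nat (3 * int u - 4 * int v)" and "v' = nat (3 * int v - 2 * int u)"
      have iu: "int u' = 3 * int u - 4 * int v" and iv: "int v' = 3 * int v - 2 * int u"
        using a b by (simp_all add: u'_def v'_def)
      have "v' < v" "u' > 0" "v' > 0" using iu iv a b vu by linarith+
      moreover have "(int u')\<^sup>2 - 2 * (int v')\<^sup>2 = -1"
        unfolding iu iv using eq by (simp add: power2_eq_square algebra_simps)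
      ultimately obtain k where k: "k \<ge> 1" "u' = pell_u k" "v' = pell_v k"
        using less.IH by blast
      have "int u = int (pell_u (Suc k))" "int v = int (pell_v (Suc k))"
        using iu iv k by (simp_all add: neg_pell_Suc)
      thus ?thesis using k by (intro exI[of _ "Suc k"]) simp
    qed
  qed
qed

end

theory Submission
  imports Defs "HOL-Computational_Algebra.Polynomial" "HOL-Computational_Algebra.Nth_Powers"
begin

text \<open>
  Write \<open>n = 2 m\<close>, \<open>A = a\<^sup>m\<close>, \<open>B = b\<^sup>m\<close>, so that \<open>(A\<^sup>2 + 1) (B\<^sup>2 + 1)\<close> is a square, and let
  \<open>x\<^sub>k(c) + y\<^sub>k(c) \<surd>(c\<^sup>2 + 1) = (c + \<surd>(c\<^sup>2 + 1))\<^sup>k\<close>. If \<open>c = sinh \<tau>\<close> and \<open>k\<close> is odd, then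
  \<open>x\<^sub>k(c) = sinh (k \<tau>)\<close>. Putting \<open>A = sinh \<alpha>\<close> and \<open>B = sinh \<beta>\<close>, the integer \<open>sinh (\<beta> - 2 \<alpha>)\<close> can take
  the place of \<open>B\<close> without changing \<open>gcd A B\<close> or the square property. This Euclidean algorithm on
  \<open>(\<alpha>, \<beta>)\<close> shows that \<open>A = x\<^sub>i(c)\<close> and \<open>B = x\<^sub>j(c)\<close> with \<open>c = gcd A B = g\<^sup>m\<close> and \<open>i < j\<close> odd and
  coprime (\<open>square_pair_param\<close>). The size estimates in (ii) and (iii) follow from \<open>x\<^sub>k(c) > c\<^sup>2\<close> for odd
  \<open>k > 1\<close>. For \<open>c = 1\<close> the \<open>x\<^sub>k(c)\<close> with \<open>k\<close> odd are the numbers \<open>u\<^sub>r\<close>, so (i) follows once \<open>m = 1\<close>.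
  What remains is that \<open>m\<close> is odd, and that \<open>m = 1\<close> when \<open>g = 1\<close>.

  If \<open>m\<close> is even, \<open>A\<close> and \<open>B\<close> are squares and \<open>c\<close> is a square \<open>c\<^sub>0\<^sup>2\<close>, so \<open>x\<^sub>j(c\<^sub>0\<^sup>2)\<close> is a square with
  \<open>j > 1\<close>. This cannot be (\<open>pell_x_square_arg_not_square\<close>). The Jacobi symbols of the quotients
  \<open>x\<^sub>k(c) / c\<close> among each other are those of the indices (\<open>jacobi_seq_eq\<close>), so a square
  quotient has a square index, and \<open>j\<close> is a square. For a prime \<open>p\<close> dividing \<open>j\<close> one can split off
  the index \<open>p\<^sup>2\<close> and arrive at \<open>x\<^sub>l(C\<^sup>2) = B\<^sup>2\<close> with \<open>l = p\<^sup>2\<close> and, what matters, \<open>p\<close> dividing \<open>C\<close>.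
  Since \<open>l\<close> is \<open>1\<close> modulo \<open>4\<close>, \<open>B\<^sup>2 + \<i> = (C\<^sup>2 + \<i>) s\<^sup>2\<close> for a Gaussian integer \<open>s\<close>; this is a Pell equation
  with fundamental solution \<open>C + \<surd>(C\<^sup>2 + \<i>)\<close>, so up to a unit \<open>B\<close> is the rational part of a power of
  it (\<open>gaussian_pell\<close>). Such a rational part is, up to a unit, \<open>C\<close> times the value of an integer polynomial at
  \<open>- \<i> C\<^sup>2\<close>, and that value is not real, because \<open>p\<close>-adically its imaginary part is dominated by
  the linear term of the polynomial (\<open>Im_pell_poly_nonzero\<close>).

  If \<open>g = 1\<close> and the odd number \<open>m\<close> exceeds \<open>1\<close>, then \<open>b\<^sup>2\<^sup>m + 1 = 2 y\<^sup>2\<close> gives a solution of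
  \<open>b\<^sup>2\<^sup>p + 1 = 2 y\<^sup>2\<close> with \<open>b > 1\<close> and an odd prime \<open>p\<close>, which does not exist
  (\<open>power_plus_one_double_square\<close>). Let \<open>E\<^sub>q = (b\<^sup>2\<^sup>q + 1) / (b\<^sup>2 + 1)\<close>. If \<open>p\<close> does not divide \<open>b\<^sup>2 + 1\<close>,
  then \<open>E\<^sub>p\<close> is a square, hence \<open>b\<^sup>p = x\<^sub>j(b)\<close> for some \<open>j < p\<close>, while divisibility of \<open>x\<^sub>j(b) / b\<close> by
  \<open>b\<^sup>p\<^sup>-\<^sup>1\<close> forces \<open>j\<close> to be larger. If \<open>p\<close> divides \<open>b\<^sup>2 + 1\<close>, then \<open>E\<^sub>p\<close> is \<open>p\<close> times a square; the Jacobi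
  symbols of the \<open>E\<^sub>q\<close> among each other are all \<open>1\<close>, and \<open>E\<^sub>l\<close> is \<open>l\<close> modulo \<open>p\<close>, so every odd \<open>l\<close>
  prime to \<open>p\<close> would be a quadratic residue modulo \<open>p\<close>.
\<close>

section \<open>Powers of \<open>c + \<surd>(c\<^sup>2 + d)\<close>\<close>

text \<open>
  The coefficients in \<open>(c + \<surd>(c\<^sup>2 + d))\<^sup>k = pell_x c d k + pell_y c d k * \<surd>(c\<^sup>2 + d)\<close>. The ring is arbitrary
  because the proof needs \<open>d = 1\<close> over the integers and \<open>d = \<i>\<close> over the Gaussian integers.
\<close>
fun pell_x :: "'a::comm_ring_1 \<Rightarrow> 'a \<Rightarrow> nat \<Rightarrow> 'a" and pell_y :: "'a \<Rightarrow> 'a \<Rightarrow> nat \<Rightarrow> 'a" where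
  "pell_x c d 0 = 1"
| "pell_x c d (Suc k) = c * pell_x c d k + (c\<^sup>2 + d) * pell_y c d k"
| "pell_y c d 0 = 0"
| "pell_y c d (Suc k) = pell_x c d k + c * pell_y c d k"

lemma pell_add:
  "pell_x c d (m + n) = pell_x c d m * pell_x c d n + (c\<^sup>2 + d) * pell_y c d m * pell_y c d n"
  "pell_y c d (m + n) = pell_x c d m * pell_y c d n + pell_y c d m * pell_x c d n"
  by (induction m) (simp_all add: algebra_simps)

lemma pell_norm: "(pell_x c d k)\<^sup>2 - (c\<^sup>2 + d) * (pell_y c d k)\<^sup>2 = (- d) ^ k"
proof (induction k)
  case (Suc k)
  have "(pell_x c d (Suc k))\<^sup>2 - (c\<^sup>2 + d) * (pell_y c d (Suc k))\<^sup>2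
      = (- d) * ((pell_x c d k)\<^sup>2 - (c\<^sup>2 + d) * (pell_y c d k)\<^sup>2)"
    by (simp add: power2_eq_square algebra_simps)
  with Suc show ?case by simp
qed simp

lemma pell_norm_odd:
  assumes "odd k"
  shows "(pell_x c 1 k)\<^sup>2 + 1 = (c\<^sup>2 + 1) * (pell_y c 1 k)\<^sup>2"
  using pell_norm[of c 1 k] assms by (simp add: algebra_simps)

text \<open>
  The addition theorem \<open>sinh (2 e + r) \<plusminus> sinh r = 2 sinh e cosh (e + r)\<close> and its companion; read modulo
  \<open>x\<^sub>e\<close>, it lets indices be reduced modulo \<open>2 e\<close>, up to sign.
\<close>
lemma pell_x_reflect:
  "pell_x c d (2 * e + r) = 2 * pell_x c d e * pell_x c d (e + r) - (- d) ^ e * pell_x c d r"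
proof -
  have "2 * e + r = e + (e + r)" by simp
  hence "pell_x c d (2 * e + r) = pell_x c d e * pell_x c d (e + r)
      + (c\<^sup>2 + d) * pell_y c d e * pell_y c d (e + r)"
    by (simp only: pell_add(1)[of c d e "e + r"])
  moreover have "pell_x c d e * pell_x c d (e + r) - (c\<^sup>2 + d) * pell_y c d e * pell_y c d (e + r)
      = (- d) ^ e * pell_x c d r"
    unfolding pell_norm[of c d e, symmetric] by (simp add: pell_add power2_eq_square algebra_simps)
  ultimately show ?thesis by (simp add: algebra_simps)
qed

text \<open>
  For odd \<open>n\<close> the \<open>n\<close>-th power is \<open>x + \<surd>(x\<^sup>2 + 1)\<close> with \<open>x = x\<^sub>n(c)\<close>, so it is again a base of the same kind.
\<close>
lemma pell_compose:
  assumes "odd n"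
  shows "pell_x c 1 (k * n) = pell_x (pell_x c 1 n) 1 k"
    and "pell_y c 1 (k * n) = pell_y c 1 n * pell_y (pell_x c 1 n) 1 k"
proof (induction k)
  case (Suc k)
  { case 1
    have "pell_x c 1 (Suc k * n) = pell_x c 1 n * pell_x c 1 (k * n)
        + ((c\<^sup>2 + 1) * pell_y c 1 n ^ 2) * pell_y (pell_x c 1 n) 1 k"
      by (simp add: pell_add Suc power2_eq_square algebra_simps)
    thus ?case unfolding pell_norm_odd[OF assms, symmetric] by (simp add: Suc)
  next
    case 2
    show ?case by (simp add: pell_add Suc algebra_simps)
  }
qed simp_all

lemma pell_pos:
  fixes c :: int
  assumes "c > 0"
  shows "pell_x c 1 k > 0" and "pell_y c 1 k \<ge> 0"
proof (induction k)
  case (Suc k)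
  { case 1
    have "c * pell_x c 1 k > 0" using assms Suc by simp
    moreover have "(c\<^sup>2 + 1) * pell_y c 1 k \<ge> 0" using Suc by simp
    ultimately show ?case by simp
  next
    case 2
    show ?case using assms Suc by simp
  }
qed simp_all

lemma pell_x_Suc_ge:
  fixes c :: int
  assumes "c > 0" "k > 0"
  shows "pell_x c 1 (Suc k) \<ge> 2 * c * pell_x c 1 k"
proof -
  obtain m where m: "k = Suc m" using assms(2) not0_implies_Suc by blast
  have "pell_x c 1 m > 0" using pell_pos assms by blast
  thus ?thesis by (simp add: m power2_eq_square algebra_simps)
qed

lemma pell_x_less:
  fixes c :: int
  assumes "c > 0" "0 < i" "i < j"
  shows "pell_x c 1 i < pell_x c 1 j"
proof -
  have inc: "pell_x c 1 k < pell_x c 1 (Suc k)" if "k > 0" for k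
  proof -
    have p: "pell_x c 1 k > 0" using pell_pos assms by blast
    have "1 * pell_x c 1 k < (2 * c) * pell_x c 1 k"
      by (rule mult_strict_right_mono) (use p assms in auto)
    thus ?thesis using pell_x_Suc_ge[OF assms(1) that] by simp
  qed
  have "Suc i \<le> j" using assms by simp
  thus ?thesis
  proof (induction j rule: dec_induct)
    case base show ?case using inc assms by blast
  next
    case (step n) thus ?case using inc[of n] by simp
  qed
qed

lemma pell_x_ge_power:
  fixes c :: int
  assumes "c > 0" "k > 0"
  shows "pell_x c 1 k \<ge> 2 ^ (k - 1) * c ^ k"
  using assms(2)
proof (induction k rule: nat_induct_non_zero)
  case (Suc n)
  obtain m where m: "n = Suc m" using Suc(1) not0_implies_Suc by blast
  have "2 ^ (Suc n - 1) * c ^ Suc n = 2 * c * (2 ^ (n - 1) * c ^ n)" by (simp add: m)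
  also have "\<dots> \<le> 2 * c * pell_x c 1 n" using Suc assms by simp
  finally show ?case using pell_x_Suc_ge[OF assms(1) Suc(1)] by simp
qed simp

section \<open>The odd-index polynomials\<close>

text \<open>
  \<open>pell_poly h\<close> evaluated at \<open>c\<^sup>2\<close> is \<open>x\<^sub>2\<^sub>h\<^sub>+\<^sub>1(c) / c\<close>; up to scaling these are Chebyshev polynomials.
\<close>
fun pell_poly :: "nat \<Rightarrow> 'a::comm_ring_1 poly" where
  "pell_poly 0 = 1"
| "pell_poly (Suc 0) = [:3, 4:]"
| "pell_poly (Suc (Suc h)) = [:2, 4:] * pell_poly (Suc h) - pell_poly h"

lemma pell_x_poly:
  fixes c d e :: "'a::comm_ring_1"
  assumes "d * e = 1"
  shows "pell_x c d (2 * h + 1) = c * d ^ h * poly (pell_poly h) (e * c\<^sup>2)"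
proof (induction h rule: pell_poly.induct)
  case 1
  show ?case by simp
next
  case 2
  have "c * d * (3 + e * c\<^sup>2 * 4) = 3 * c * d + 4 * c^3 * (d * e)"
    by (simp add: power2_eq_square power3_eq_cube algebra_simps)
  thus ?case using assms by (simp add: eval_nat_numeral algebra_simps)
next
  case (3 h)
  have idx: "2 * Suc (Suc h) + 1 = 2 * 2 + (2 * h + 1)" "2 * Suc h + 1 = 2 + (2 * h + 1)" by simp_all
  have "pell_x c d (2 * Suc (Suc h) + 1)
      = 2 * pell_x c d 2 * pell_x c d (2 * Suc h + 1) - d\<^sup>2 * pell_x c d (2 * h + 1)"
    unfolding idx pell_x_reflect by (simp only: power2_minus)
  also have "2 * pell_x c d 2 = 4 * c\<^sup>2 + 2 * d"
    by (simp add: eval_nat_numeral algebra_simps)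
  also have "(4 * c\<^sup>2 + 2 * d) = d * (4 * (e * c\<^sup>2) + 2)"
    using assms by (simp add: algebra_simps)
       (metis mult.assoc mult.left_commute mult.right_neutral)
  finally show ?case unfolding 3 by (simp add: power2_eq_square algebra_simps)
qed

lemma coeff_pell_poly_eq_0: "l > h \<Longrightarrow> coeff (pell_poly h) l = 0"
proof (induction h arbitrary: l rule: pell_poly.induct)
  case (3 h)
  then obtain m where "l = Suc m" by (cases l) auto
  with 3 show ?case by simp
qed (auto simp: coeff_pCons split: nat.splits)

lemma coeff_pell_poly_of_int:
  "coeff (pell_poly h :: 'a::comm_ring_1 poly) l = of_int (coeff (pell_poly h) l)"
proof (induction h arbitrary: l rule: pell_poly.induct)
  case (3 h)
  thus ?case by (cases l) simp_all
qed (auto simp: coeff_pCons split: nat.splits)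

lemma poly_pell_poly:
  "poly (pell_poly h) z = (\<Sum>l\<le>h. of_int (coeff (pell_poly h) l) * z ^ l)"
proof -
  have "degree (pell_poly h :: 'a poly) \<le> h"
    by (rule degree_le) (simp add: coeff_pell_poly_eq_0)
  thus ?thesis
    unfolding poly_altdef coeff_pell_poly_of_int[symmetric]
    by (intro sum.mono_neutral_left) (auto simp: coeff_eq_0)
qed

text \<open>
  For \<open>n \<ge> l\<close> this is \<open>(n + l)! / (n - l)!\<close>, the product of the \<open>2 l\<close> consecutive integers around \<open>n + 1/2\<close>.
\<close>
definition mid_prod :: "int \<Rightarrow> nat \<Rightarrow> int" where
  "mid_prod n l = (\<Prod>i<l. (n + 1 + int i) * (n - int i))"

lemma mid_prod_simps [simp]:
  "mid_prod n 0 = 1"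
  "mid_prod n (Suc l) = mid_prod n l * ((n + 1 + int l) * (n - int l))"
  by (simp_all add: mid_prod_def)

lemma mid_prod_eq_0: "h < l \<Longrightarrow> mid_prod (int h) l = 0"
  unfolding mid_prod_def by (rule prod_zero) auto

lemma mid_prod_shift:
  "mid_prod (n + 1) (Suc l) = mid_prod n l * ((n + int l + 1) * (n + int l + 2))"
  "mid_prod (n - 1) (Suc l) = mid_prod n l * ((n - int l - 1) * (n - int l))"
proof (induction l)
  case (Suc l)
  { case 1
    show ?case
      unfolding mid_prod_simps(2)[of "n + 1" "Suc l"] Suc(1)
      by (simp add: algebra_simps)
  next
    case 2
    show ?case
      unfolding mid_prod_simps(2)[of "n - 1" "Suc l"] Suc(2)
      by (simp add: algebra_simps)
  }
qed (simp_all add: algebra_simps)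

lemma coeff_pell_poly:
  "fact (2 * l + 1) * coeff (pell_poly h :: int poly) l
     = 4 ^ l * (2 * int h + 1) * mid_prod (int h) l"
proof (induction h arbitrary: l rule: pell_poly.induct)
  case 1
  show ?case
  proof (cases l)
    case (Suc m) thus ?thesis using mid_prod_eq_0[of 0 l] by (simp add: coeff_pell_poly_eq_0)
  qed simp
next
  case 2
  consider "l = 0" | "l = 1" | "l > 1" by linarith
  thus ?case
  proof cases
    case 3 thus ?thesis using mid_prod_eq_0[of 1 l] coeff_pell_poly_eq_0[of 1 l] by simp
  qed (simp_all add: eval_nat_numeral)
next
  case (3 h)
  show ?case
  proof (cases l)
    case 0 thus ?thesis using 3[of 0] by (simp add: mid_prod_def)
  next
    case (Suc m)
    define n where "n = int h + 1"
    have f: "fact (2 * l + 1) = (2 * int m + 3) * (2 * int m + 2) * fact (2 * m + 1)"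
      unfolding Suc by (simp add: algebra_simps)
    have "fact (2 * l + 1) * coeff (pell_poly (Suc (Suc h)) :: int poly) l
      = 4 * (2 * int m + 3) * (2 * int m + 2) * (fact (2 * m + 1) * coeff (pell_poly (Suc h)) m)
        + 2 * (fact (2 * l + 1) * coeff (pell_poly (Suc h)) l)
        - fact (2 * l + 1) * coeff (pell_poly h) l"
      unfolding f by (simp add: Suc algebra_simps)
    also have "\<dots> = 4 * (2 * int m + 3) * (2 * int m + 2) * (4 ^ m * (2 * n + 1) * mid_prod n m)
        + 2 * (4 ^ Suc m * (2 * n + 1) * mid_prod n (Suc m))
        - 4 ^ Suc m * (2 * n - 1) * mid_prod (n - 1) (Suc m)"
      unfolding 3 by (simp add: n_def Suc algebra_simps)
    also have "mid_prod n (Suc m) = mid_prod n m * (n + 1 + int m) * (n - int m)"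
      by (simp add: mid_prod_def)
    also have "4 * (2 * int m + 3) * (2 * int m + 2) * (4 ^ m * (2 * n + 1) * mid_prod n m)
        + 2 * (4 ^ Suc m * (2 * n + 1) * (mid_prod n m * (n + 1 + int m) * (n - int m)))
        - 4 ^ Suc m * (2 * n - 1) * mid_prod (n - 1) (Suc m)
        = 4 ^ Suc m * (2 * n + 3) * mid_prod (n + 1) (Suc m)"
      unfolding mid_prod_shift by (simp add: algebra_simps)
    finally show ?thesis by (simp add: n_def Suc algebra_simps)
  qed
qed

text \<open>
  The quotient \<open>x\<^sub>k(c) / c\<close>, meant for odd \<open>k\<close>.
\<close>
definition pell_w :: "int \<Rightarrow> nat \<Rightarrow> int" where
  "pell_w c k = poly (pell_poly (k div 2)) (c\<^sup>2)"

lemma pell_x_eq_w: "odd k \<Longrightarrow> pell_x c 1 k = c * pell_w c k"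
  by (elim oddE) (use pell_x_poly[of 1 1 c] in \<open>simp add: pell_w_def\<close>)

lemma pell_poly_cong: "4 * z dvd poly (pell_poly h) z - (2 * int h + 1)"
proof (induction h rule: pell_poly.induct)
  case (3 h)
  have "poly (pell_poly (Suc (Suc h))) z - (2 * int (Suc (Suc h)) + 1)
      = 4 * z * poly (pell_poly (Suc h)) z + 2 * (poly (pell_poly (Suc h)) z - (2 * int (Suc h) + 1))
        - (poly (pell_poly h) z - (2 * int h + 1))"
    by (simp add: algebra_simps)
  thus ?case using 3 by (metis dvd_add dvd_diff dvd_mult dvd_triv_left)
qed simp_all

lemma pell_w_cong: "odd k \<Longrightarrow> 4 * c\<^sup>2 dvd pell_w c k - int k"
  by (elim oddE) (use pell_poly_cong[of "c\<^sup>2"] in \<open>simp add: pell_w_def algebra_simps\<close>)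

lemma pell_w_pos:
  assumes "c > 0" "odd k"
  shows "pell_w c k > 0"
  using pell_pos(1)[OF assms(1), of k] pell_x_eq_w[OF assms(2), of c] assms(1)
  by (simp add: zero_less_mult_iff)

lemma pell_w_cong_4: "odd k \<Longrightarrow> [pell_w c k = int k] (mod 4)"
  using pell_w_cong[of k c] by (auto simp: cong_iff_dvd_diff intro: dvd_trans[of 4 "4 * c\<^sup>2"])

lemma pell_w_odd: "odd k \<Longrightarrow> odd (pell_w c k)"
  using pell_w_cong_4[of k c] unfolding cong_iff_dvd_diff
  by (metis dvd_diff_right_iff even_of_nat dvd_trans even_numeral)

section \<open>The Jacobi symbol\<close>

definition jacobi :: "int \<Rightarrow> nat \<Rightarrow> int" where
  "jacobi a n = (\<Prod>p\<in>#prime_factorization n. Legendre a (int p))"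

lemma odd_nat_mult_induct [consumes 1, case_names one prime_mult]:
  fixes n :: nat
  assumes "odd n"
    and "P 1"
    and "\<And>p n. prime p \<Longrightarrow> odd p \<Longrightarrow> odd n \<Longrightarrow> P n \<Longrightarrow> P (p * n)"
  shows "P n"
  using assms(1)
proof (induction n rule: less_induct)
  case (less n)
  show ?case
  proof (cases "n = 1")
    case False
    then obtain p where p: "prime p" "p dvd n" using prime_factor_nat by blast
    then obtain m where m: "n = p * m" by blast
    with less.prems have o: "odd p" "odd m" by simp_all
    have "m < n" using m o(2) prime_gt_1_nat[OF p(1)] by (simp add: odd_pos)
    hence "P m" using less.IH o by simp
    thus ?thesis unfolding m by (rule assms(3)[OF p(1) o])
  qed (use assms(2) in simp)
qed

lemma Legendre_cong:
  assumes "[a = b] (mod p)"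
  shows "Legendre a p = Legendre b p"
proof -
  have "[a = 0] (mod p) \<longleftrightarrow> [b = 0] (mod p)" using assms cong_sym cong_trans by blast
  moreover have "QuadRes p a \<longleftrightarrow> QuadRes p b"
    unfolding QuadRes_def using assms cong_sym cong_trans by blast
  ultimately show ?thesis by (simp add: Legendre_def)
qed

lemma Legendre_eqI:
  assumes "prime p" "odd p" "[Legendre a (int p) = e] (mod int p)" "e \<in> {-1, 0, 1}"
  shows "Legendre a (int p) = e"
proof -
  have "p > 2" using assms(1,2) prime_ge_2_nat[of p] by (cases "p = 2") simp_all
  define v where "v = Legendre a (int p)"
  have "v \<in> {-1, 0, 1}" by (auto simp: v_def Legendre_def)
  moreover have "int p dvd v - e" using assms(3) by (simp add: v_def cong_iff_dvd_diff)
  ultimately have "\<bar>v - e\<bar> < int p" using \<open>p > 2\<close> assms(4) by auto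
  moreover have "v - e \<noteq> 0 \<Longrightarrow> \<bar>int p\<bar> \<le> \<bar>v - e\<bar>"
    using dvd_imp_le_int \<open>int p dvd v - e\<close> by blast
  ultimately have "v - e = 0" by linarith
  thus ?thesis by (simp add: v_def)
qed

lemma Legendre_euler:
  assumes "prime p" "odd p"
  shows "[Legendre a (int p) = a ^ ((p - 1) div 2)] (mod int p)"
proof -
  have "p > 2" using assms(1,2) prime_ge_2_nat[of p] by (cases "p = 2") simp_all
  thus ?thesis using euler_criterion assms(1) by blast
qed

lemma Legendre_mult:
  assumes "prime p" "odd p"
  shows "Legendre (a * b) (int p) = Legendre a (int p) * Legendre b (int p)"
proof (rule Legendre_eqI[OF assms])
  have "[Legendre a (int p) * Legendre b (int p) = (a * b) ^ ((p - 1) div 2)] (mod int p)"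
    unfolding power_mult_distrib by (intro cong_mult Legendre_euler assms)
  thus "[Legendre (a * b) (int p) = Legendre a (int p) * Legendre b (int p)] (mod int p)"
    by (rule cong_trans[OF Legendre_euler[OF assms] cong_sym])
qed (auto simp: Legendre_def)

lemma Legendre_neg_one:
  assumes "prime p" "odd p"
  shows "Legendre (-1) (int p) = (if p mod 4 = 1 then 1 else -1)"
proof (rule Legendre_eqI[OF assms])
  have "even ((p - 1) div 2) \<longleftrightarrow> p mod 4 = 1" using assms(2) by presburger
  hence "(-1 :: int) ^ ((p - 1) div 2) = (if p mod 4 = 1 then 1 else -1)" by simp
  thus "[Legendre (-1) (int p) = (if p mod 4 = 1 then 1 else -1)] (mod int p)"
    using Legendre_euler[OF assms, of "-1"] by (simp only:)
qed auto

lemma jacobi_1_right [simp]: "jacobi a 1 = 1" "jacobi a (Suc 0) = 1"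
  by (simp_all add: jacobi_def)

lemma jacobi_mult_right:
  assumes "m > 0" "n > 0"
  shows "jacobi a (m * n) = jacobi a m * jacobi a n"
  using assms by (simp add: jacobi_def prime_factorization_mult)

lemma jacobi_prime: "prime p \<Longrightarrow> jacobi a p = Legendre a (int p)"
  by (simp add: jacobi_def prime_factorization_prime)

lemma jacobi_prime_mult:
  assumes "prime p" "odd n"
  shows "jacobi a (p * n) = Legendre a (int p) * jacobi a n"
  using assms by (simp add: jacobi_mult_right jacobi_prime prime_gt_0_nat odd_pos)

lemma jacobi_cong:
  assumes "odd n" "[a = b] (mod int n)"
  shows "jacobi a n = jacobi b n"
  using assms
proof (induction n rule: odd_nat_mult_induct)
  case (prime_mult p n)
  have "[a = b] (mod int p)" "[a = b] (mod int n)"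
    by (rule cong_dvd_modulus[OF prime_mult.prems], simp)+
  hence e: "Legendre a (int p) = Legendre b (int p)" "jacobi a n = jacobi b n"
    using prime_mult.IH Legendre_cong by blast+
  show ?case unfolding jacobi_prime_mult[OF prime_mult(1,3)] e ..
qed simp

lemma jacobi_mult_left:
  assumes "odd n"
  shows "jacobi (a * b) n = jacobi a n * jacobi b n"
  using assms
proof (induction n rule: odd_nat_mult_induct)
  case (prime_mult p n)
  show ?case
    unfolding jacobi_prime_mult[OF prime_mult(1,3)] Legendre_mult[OF prime_mult(1,2)] prime_mult.IH
    by (simp only: mult_ac)
qed simp

lemma jacobi_1_left:
  assumes "odd n"
  shows "jacobi 1 n = 1"
  using assms
proof (induction n rule: odd_nat_mult_induct)
  case (prime_mult p n)
  have "Legendre 1 (int p) = 1"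
  proof -
    have "QuadRes (int p) 1" unfolding QuadRes_def by (rule exI[of _ 1]) simp
    moreover have "\<not> [1 = 0] (mod int p)"
      using prime_gt_1_nat[OF prime_mult(1)] by (simp add: cong_0_iff)
    ultimately show ?thesis by (simp add: Legendre_def)
  qed
  thus ?case using prime_mult by (simp add: jacobi_prime_mult)
qed simp

lemma jacobi_range: "odd n \<Longrightarrow> jacobi a n \<in> {-1, 0, 1}"
proof (induction n rule: odd_nat_mult_induct)
  case (prime_mult p n)
  have "Legendre a (int p) \<in> {-1, 0, 1}" by (auto simp: Legendre_def)
  thus ?case using prime_mult by (auto simp add: jacobi_prime_mult)
qed simp

lemma jacobi_nonzero:
  assumes "odd n" "coprime a (int n)"
  shows "jacobi a n \<noteq> 0"
  using assms
proof (induction n rule: odd_nat_mult_induct)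
  case (prime_mult p n)
  have c: "coprime a (int p)" "coprime a (int n)" using prime_mult.prems by simp_all
  have "\<not> [a = 0] (mod int p)"
    using c(1) prime_mult(1) by (auto simp: cong_0_iff coprime_absorb_right)
  thus ?case using prime_mult c by (auto simp add: jacobi_prime_mult Legendre_def)
qed simp

lemma jacobi_eq_0:
  assumes "odd n" "\<not> coprime a (int n)"
  shows "jacobi a n = 0"
  using assms
proof (induction n rule: odd_nat_mult_induct)
  case (prime_mult p n)
  show ?case
  proof (cases "coprime a (int n)")
    case True
    hence "\<not> coprime a (int p)" using prime_mult.prems by simp
    hence "int p dvd a"
      using prime_imp_coprime[of "int p" a] prime_mult(1) by (auto simp: coprime_commute)
    thus ?thesis using prime_mult by (simp add: jacobi_prime_mult Legendre_def cong_0_iff)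
  qed (use prime_mult in \<open>simp add: jacobi_prime_mult\<close>)
qed simp

lemma jacobi_square:
  assumes "odd n" "coprime a (int n)"
  shows "jacobi (a\<^sup>2) n = 1"
  using jacobi_range[OF assms(1), of a] jacobi_nonzero[OF assms]
  by (auto simp: power2_eq_square jacobi_mult_left assms)

lemma mod_4_mult_cases:
  fixes m n :: nat
  assumes "odd m" "odd n"
  shows "(m mod 4 = 1 \<or> m mod 4 = 3) \<and> (n mod 4 = 1 \<or> n mod 4 = 3)
    \<and> (m * n mod 4 = 1 \<longleftrightarrow> m mod 4 = n mod 4) \<and> (m * n mod 4 = 3 \<longleftrightarrow> m mod 4 \<noteq> n mod 4)"
proof -
  have "m mod 4 = 1 \<or> m mod 4 = 3" "n mod 4 = 1 \<or> n mod 4 = 3" using assms by presburger+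
  moreover have "m * n mod 4 = (m mod 4) * (n mod 4) mod 4" by (simp add: mod_mult_eq)
  ultimately show ?thesis by auto
qed

lemma jacobi_neg_one:
  assumes "odd n"
  shows "jacobi (-1) n = (if n mod 4 = 1 then 1 else -1)"
  using assms
proof (induction n rule: odd_nat_mult_induct)
  case (prime_mult p n)
  thus ?case using mod_4_mult_cases[of p n]
    by (auto simp: jacobi_prime_mult Legendre_neg_one)
qed simp

text \<open>
  For odd \<open>m\<close> and \<open>n\<close> this is \<open>(-1)\<close> to the power \<open>(m - 1)/2 \<cdot> (n - 1)/2\<close>, in the form in which it visibly depends on residues
  modulo \<open>4\<close> only.
\<close>
definition recip_sign :: "nat \<Rightarrow> nat \<Rightarrow> int" where
  "recip_sign m n = (if m mod 4 = 3 \<and> n mod 4 = 3 then -1 else 1)"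

lemma recip_sign_mult:
  assumes "odd m" "odd n"
  shows "recip_sign (m * n) k = recip_sign m k * recip_sign n k"
    and "recip_sign k (m * n) = recip_sign k m * recip_sign k n"
  using mod_4_mult_cases[OF assms] by (auto simp: recip_sign_def)

lemma Legendre_reciprocity:
  assumes "prime p" "odd p" "prime q" "odd q"
  shows "Legendre (int p) (int q) = recip_sign p q * Legendre (int q) (int p)"
proof (cases "p = q")
  case True thus ?thesis by (simp add: Legendre_def cong_0_iff)
next
  case False
  have "p > 2" "q > 2"
    using assms prime_ge_2_nat[of p] prime_ge_2_nat[of q] by (cases "p = 2", simp_all, cases "q = 2", simp_all)
  hence "Legendre (int p) (int q) * Legendre (int q) (int p)
      = (-1) ^ ((p - 1) div 2 * ((q - 1) div 2))"
    using Quadratic_Reciprocity assms False by blast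
  moreover have "odd ((p - 1) div 2 * ((q - 1) div 2)) \<longleftrightarrow> p mod 4 = 3 \<and> q mod 4 = 3"
  proof -
    have "odd ((p - 1) div 2) \<longleftrightarrow> p mod 4 = 3" "odd ((q - 1) div 2) \<longleftrightarrow> q mod 4 = 3"
      using assms by presburger+
    thus ?thesis by simp
  qed
  ultimately have "Legendre (int p) (int q) * Legendre (int q) (int p) = recip_sign p q"
    by (auto simp: recip_sign_def)
  moreover have "Legendre (int q) (int p) \<in> {-1, 0, 1}" by (auto simp: Legendre_def)
  moreover have "recip_sign p q \<noteq> 0" by (simp add: recip_sign_def)
  ultimately show ?thesis by auto
qed

theorem jacobi_reciprocity:
  assumes "odd m" "odd n"
  shows "jacobi (int m) n = recip_sign m n * jacobi (int n) m"
proof -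
  have prime: "jacobi (int p) n = recip_sign p n * Legendre (int n) (int p)"
    if "prime p" "odd p" for p
    using assms(2)
  proof (induction n rule: odd_nat_mult_induct)
    case one
    show ?case using jacobi_1_left[of p] that by (simp add: recip_sign_def jacobi_prime)
  next
    case (prime_mult q n)
    thus ?case using that
      by (simp add: jacobi_prime_mult recip_sign_mult Legendre_mult Legendre_reciprocity[OF that])
  qed
  show ?thesis using assms(1)
  proof (induction m rule: odd_nat_mult_induct)
    case one
    show ?case using jacobi_1_left assms by (simp add: recip_sign_def)
  next
    case (prime_mult p m)
    thus ?case using assms prime
      by (simp add: jacobi_prime_mult recip_sign_mult jacobi_mult_left)
  qed
qed

section \<open>Detecting squares with Jacobi symbols\<close>

lemma prime_nonresidue:
  assumes "prime q" "odd q"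
  shows "\<exists>a. Legendre (int a) (int q) = -1"
proof -
  have q: "q > 2" using assms prime_ge_2_nat[of q] by (cases "q = 2") simp_all
  obtain a where a: "residue_primroot q a"
    using prime_primitive_root_exists[of q] assms q by auto
  hence ord: "ord q a = q - 1" and cop: "coprime q a"
    using totient_prime[OF assms(1)] by (simp_all add: residue_primroot_def)
  have "Legendre (int a) (int q) \<noteq> 1"
  proof
    assume "Legendre (int a) (int q) = 1"
    hence "[1 = int a ^ ((q - 1) div 2)] (mod int q)"
      using Legendre_euler[OF assms, of "int a"] by simp
    hence "[a ^ ((q - 1) div 2) = 1] (mod q)"
      by (metis cong_int_iff cong_sym of_nat_1 of_nat_power)
    hence "q - 1 dvd (q - 1) div 2" using ord_divides ord by metis
    moreover have "(q - 1) div 2 > 0" "(q - 1) div 2 < q - 1" using q by simp_all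
    ultimately show False using dvd_imp_le not_le by blast
  qed
  moreover have "Legendre (int a) (int q) \<noteq> 0"
  proof
    assume "Legendre (int a) (int q) = 0"
    hence "q dvd a" by (simp add: Legendre_def cong_0_iff split: if_splits)
    with cop have "is_unit q" by (simp add: coprime_absorb_left)
    thus False using q by simp
  qed
  ultimately show ?thesis by (auto simp: Legendre_def split: if_splits)
qed

text \<open>
  Some prime \<open>q\<close> divides \<open>k\<close> to an odd power. Choose \<open>l\<close> to be a nonresidue modulo \<open>q\<close> and \<open>1\<close> modulo four
  times the rest of \<open>k\<close>; reciprocity then has trivial sign and only \<open>q\<close> contributes.
\<close>
lemma nonsquare_jacobi:
  fixes k :: nat
  assumes "odd k" "\<nexists>m. k = m\<^sup>2"
  shows "\<exists>l. l mod 4 = 1 \<and> jacobi (int k) l = -1"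
proof -
  have "\<not> is_nth_power 2 k" using assms(2) by (simp add: is_nth_power_def)
  then obtain q where q: "prime q" "odd (multiplicity q k)"
    using is_nth_power_conv_multiplicity_nat[of 2 k] by auto
  define e where "e = multiplicity q k"
  have "k \<noteq> 0" "\<not> is_unit q" using assms(1) q(1) by (auto intro!: Nat.gr0I)
  then obtain k' where k': "k = q ^ e * k'" "\<not> q dvd k'"
    using multiplicity_decompose'[of k q] unfolding e_def by metis
  have e: "e \<noteq> 0" using q(2) by (auto simp: e_def elim: oddE)
  have o: "odd q" "odd k'" using assms(1) k' e by simp_all
  obtain a where a: "Legendre (int a) (int q) = -1" using prime_nonresidue q(1) o(1) by blast
  have "coprime q (4 * k')"
  proof -
    have "coprime q k'" using q(1) k'(2) by (rule prime_imp_coprime)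
    moreover have "coprime q (2 ^ 2)" using o(1) by (simp only: coprime_power_right_iff) (simp add: coprime_right_2_iff_odd)
    ultimately show ?thesis by simp
  qed
  then obtain l where l: "[l = a] (mod q)" "[l = 1] (mod (4 * k'))"
    using binary_chinese_remainder_nat by blast
  have l4: "l mod 4 = 1" and lk: "[l = 1] (mod k')"
    using l(2) cong_dvd_modulus_nat[of l 1 "4 * k'"] by (simp_all add: cong_def[of l 1 4, symmetric])
       (auto simp: cong_def)
  hence "odd l" by presburger
  have "jacobi (int k) l = jacobi (int l) k"
    using jacobi_reciprocity[OF assms(1) \<open>odd l\<close>] l4 by (simp add: recip_sign_def)
  also have "\<dots> = jacobi (int l) (q ^ e) * jacobi (int l) k'"
    unfolding k' using o q(1) by (intro jacobi_mult_right) (simp_all add: prime_gt_0_nat odd_pos)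
  also have "jacobi (int l) k' = 1"
    using jacobi_cong[OF o(2), of "int l" 1] lk jacobi_1_left[OF o(2)]
    by (metis cong_int_iff of_nat_1)
  also have "jacobi (int l) (q ^ e) = (-1) ^ e"
  proof -
    have "Legendre (int l) (int q) = -1"
      using a Legendre_cong[of "int l" "int a" "int q"] l(1) by (simp add: cong_int_iff)
    hence "jacobi (int l) (q ^ m) = (-1) ^ m" for m
      by (induction m) (use q(1) o(1) in \<open>simp_all add: jacobi_prime_mult\<close>)
    thus ?thesis .
  qed
  also have "(-1) ^ e = (-1 :: int)" using q(2) by (simp add: e_def)
  finally show ?thesis using l4 by auto
qed

text \<open>
  Sequences whose Jacobi symbols follow the reductions \<open>k \<mapsto> k - 2 l\<close> and \<open>k \<mapsto> 2 l - k\<close> of the upper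
  index modulo the lower one, exactly as the symbols of the integers themselves do.
\<close>
definition jacobi_seq :: "(nat \<Rightarrow> int) \<Rightarrow> bool" where
  "jacobi_seq f \<longleftrightarrow> f 1 = 1 \<and> (\<forall>k. odd k \<longrightarrow> f k > 0 \<and> odd (f k))
     \<and> (\<forall>l r. odd l \<longrightarrow> odd r \<longrightarrow> jacobi (f (2 * l + r)) (nat (f l)) = jacobi (f r) (nat (f l)))
     \<and> (\<forall>l t. odd l \<longrightarrow> even t \<longrightarrow> t < l \<longrightarrow>
          jacobi (f (l + t)) (nat (f l)) = jacobi (-1) (nat (f l)) * jacobi (f (l - t)) (nat (f l)))"

lemma jacobi_seq_pos:
  assumes "jacobi_seq f" "odd k"
  shows "f k > 0" "odd (nat (f k))" "int (nat (f k)) = f k"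
proof -
  have "f k > 0" "odd (f k)" using assms by (auto simp: jacobi_seq_def)
  thus "f k > 0" "odd (nat (f k))" "int (nat (f k)) = f k" by (simp_all add: even_nat_iff)
qed

text \<open>
  The Euclidean algorithm on the indices, together with reciprocity for exchanging them, computes the
  symbol. Apart from residues modulo \<open>4\<close> it never looks at the values, so two sequences
  that agree modulo \<open>4\<close> have the same symbols.
\<close>
lemma jacobi_seq_eq:
  assumes f: "jacobi_seq f" and g: "jacobi_seq g"
    and cong: "\<And>k. odd k \<Longrightarrow> [f k = g k] (mod 4)"
    and "odd k" "odd l" "coprime k l"
  shows "jacobi (f k) (nat (f l)) = jacobi (g k) (nat (g l))"
  using assms(4-6)
proof (induction l arbitrary: k rule: less_induct)
  case (less l)
  note outer = less.IH
  note f' = f[unfolded jacobi_seq_def] and g' = g[unfolded jacobi_seq_def]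
  have mod4: "nat (f j) mod 4 = nat (g j) mod 4" if "odd j" for j
  proof -
    have "int (nat (f j) mod 4) = int (nat (g j) mod 4)"
      using cong[OF that] jacobi_seq_pos(3)[OF f that] jacobi_seq_pos(3)[OF g that]
      by (simp add: zmod_int cong_def)
    thus ?thesis by simp
  qed
  have neg: "jacobi (-1) (nat (f l)) = jacobi (-1) (nat (g l))"
    unfolding jacobi_neg_one[OF jacobi_seq_pos(2)[OF f less.prems(2)]]
      jacobi_neg_one[OF jacobi_seq_pos(2)[OF g less.prems(2)]] mod4[OF less.prems(2)] ..
  show ?case using less.prems
  proof (induction k rule: less_induct)
    case (less k)
    consider "l = 1" | "k < l" | "k > 2 * l" | "l \<noteq> 1" "k = l" | "k = 2 * l" | "l < k" "k < 2 * l"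
      by linarith
    thus ?case
    proof cases
      case 1
      thus ?thesis using f' g' by simp
    next
      case 2
      have swap: "jacobi (h k) (nat (h l)) = recip_sign (nat (h k)) (nat (h l)) * jacobi (h l) (nat (h k))"
        if "jacobi_seq h" for h
        using jacobi_reciprocity[of "nat (h k)" "nat (h l)"] jacobi_seq_pos(2,3)[OF that] less.prems
        by simp
      note swap[OF f] swap[OF g]
      moreover have "recip_sign (nat (f k)) (nat (f l)) = recip_sign (nat (g k)) (nat (g l))"
        using mod4 less.prems by (simp add: recip_sign_def)
      moreover have "jacobi (f l) (nat (f k)) = jacobi (g l) (nat (g k))"
        using outer[OF 2] less.prems by (simp add: coprime_commute)
      ultimately show ?thesis by simp
    next
      case 3
      define r where "r = k - 2 * l"
      have k: "k = 2 * l + r" using 3 by (simp add: r_def)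
      have r: "odd r" "r < k" using less.prems k by (simp_all add: odd_pos)
      have "coprime r l"
        using less.prems(3) unfolding k
        by (metis add.commute coprime_iff_gcd_eq_1 gcd_add_mult mult.commute gcd.commute)
      thus ?thesis using less.IH[OF r(2)] r(1) less.prems f' g' unfolding k by simp
    next
      case 4
      thus ?thesis using less.prems by simp
    next
      case 5
      thus ?thesis using less.prems by simp
    next
      case 6
      define t where "t = k - l"
      have k: "k = l + t" and t: "even t" "t < l" "t > 0" using 6 less.prems by (auto simp: t_def)
      have lt: "l - t < k" "odd (l - t)" using k t less.prems by auto
      have "coprime (l - t) l"
      proof (rule coprimeI)
        fix d assume d: "d dvd l - t" "d dvd l"
        hence "d dvd t" using dvd_diff_nat[OF d(2) d(1)] t by simp
        hence "d dvd k" using d k by simp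
        thus "is_unit d" using d(2) less.prems(3) coprime_common_divisor by blast
      qed
      hence "jacobi (f (l - t)) (nat (f l)) = jacobi (g (l - t)) (nat (g l))"
        using less.IH[OF lt(1) lt(2)] less.prems by simp
      thus ?thesis using f' g' neg t less.prems(2) unfolding k by simp
    qed
  qed
qed

lemma jacobi_seq_id: "jacobi_seq int"
proof -
  have "jacobi (int (2 * l + r)) l = jacobi (int r) l" if "odd l" for l r
    using that by (intro jacobi_cong) (simp_all add: cong_iff_dvd_diff)
  moreover have "jacobi (int (l + t)) l = jacobi (-1) l * jacobi (int (l - t)) l"
    if "odd l" "t < l" for l t
  proof -
    have "jacobi (int (l + t)) l = jacobi (-1 * int (l - t)) l"
      using that by (intro jacobi_cong) (simp_all add: cong_iff_dvd_diff of_nat_diff)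
    thus ?thesis unfolding jacobi_mult_left[OF that(1)] .
  qed
  ultimately show ?thesis by (simp add: jacobi_seq_def odd_pos)
qed

lemma jacobi_seq_pell_w:
  assumes "c > 0"
  shows "jacobi_seq (pell_w c)"
  unfolding jacobi_seq_def
proof (intro conjI allI impI)
  show "pell_w c 1 = 1" by (simp add: pell_w_def)
next
  fix k :: nat assume k: "odd k"
  show "pell_w c k > 0" using pell_w_pos assms k by blast
  show "odd (pell_w c k)" using pell_w_odd k by blast
next
  fix l r :: nat assume o: "odd l" "odd r"
  have p: "pell_w c l > 0" and ol: "odd (pell_w c l)"
    using pell_w_pos pell_w_odd assms o by blast+
  have "c * pell_w c (2 * l + r) = c * (2 * pell_w c l * pell_x c 1 (l + r) + pell_w c r)"
    using pell_x_reflect[of c 1 l r] o by (simp add: pell_x_eq_w algebra_simps)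
  hence "pell_w c (2 * l + r) = 2 * pell_w c l * pell_x c 1 (l + r) + pell_w c r"
    using assms by simp
  hence "[pell_w c (2 * l + r) = pell_w c r] (mod int (nat (pell_w c l)))"
    using p by (simp add: cong_iff_dvd_diff)
  thus "jacobi (pell_w c (2 * l + r)) (nat (pell_w c l)) = jacobi (pell_w c r) (nat (pell_w c l))"
    by (rule jacobi_cong[rotated]) (use p ol in \<open>simp add: even_nat_iff\<close>)
next
  fix l t :: nat assume o: "odd l" "even t" "t < l"
  have p: "pell_w c l > 0" and ol: "odd (pell_w c l)"
    using pell_w_pos pell_w_odd assms o by blast+
  have "2 * t + (l - t) = l + t" "t + (l - t) = l" using o by simp_all
  hence "pell_x c 1 (l + t) = 2 * pell_x c 1 t * pell_x c 1 l - pell_x c 1 (l - t)"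
    using pell_x_reflect[of c 1 t "l - t"] o(2) by (simp add: add.commute)
  hence "c * pell_w c (l + t) = c * (2 * pell_x c 1 t * pell_w c l - pell_w c (l - t))"
    using o by (simp add: pell_x_eq_w algebra_simps)
  hence "pell_w c (l + t) = 2 * pell_x c 1 t * pell_w c l - pell_w c (l - t)"
    using assms by simp
  hence "[pell_w c (l + t) = -1 * pell_w c (l - t)] (mod int (nat (pell_w c l)))"
    using p by (simp add: cong_iff_dvd_diff)
  hence "jacobi (pell_w c (l + t)) (nat (pell_w c l)) = jacobi (-1 * pell_w c (l - t)) (nat (pell_w c l))"
    by (rule jacobi_cong[rotated]) (use p ol in \<open>simp add: even_nat_iff\<close>)
  thus "jacobi (pell_w c (l + t)) (nat (pell_w c l))
      = jacobi (-1) (nat (pell_w c l)) * jacobi (pell_w c (l - t)) (nat (pell_w c l))"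
    by (subst (asm) jacobi_mult_left) (use p ol in \<open>simp_all add: even_nat_iff\<close>)
qed

text \<open>
  The symbol of \<open>x\<^sub>k(c) / c\<close> over \<open>x\<^sub>l(c) / c\<close> is that of \<open>k\<close> over \<open>l\<close>, and it would be \<open>-1\<close> for a suitable \<open>l\<close>
  if \<open>k\<close> were not a square.
\<close>
lemma pell_w_square_imp_square:
  assumes "c > 0" "odd k" "pell_w c k = s\<^sup>2"
  shows "\<exists>m. k = m\<^sup>2"
proof (rule ccontr)
  assume "\<nexists>m. k = m\<^sup>2"
  then obtain l where l: "l mod 4 = 1" "jacobi (int k) l = -1"
    using nonsquare_jacobi assms(2) by blast
  have ol: "odd l" using l(1) by presburger
  have "coprime k l" using jacobi_eq_0[OF ol, of "int k"] l(2) by auto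
  hence "jacobi (pell_w c k) (nat (pell_w c l)) = -1"
    using jacobi_seq_eq[OF jacobi_seq_pell_w[OF assms(1)] jacobi_seq_id pell_w_cong_4 assms(2) ol] l(2)
    by simp
  moreover have "odd (nat (pell_w c l))"
    using jacobi_seq_pos(2)[OF jacobi_seq_pell_w[OF assms(1)] ol] .
  ultimately have "jacobi s (nat (pell_w c l)) * jacobi s (nat (pell_w c l)) = -1"
    unfolding assms(3) power2_eq_square by (simp add: jacobi_mult_left)
  thus False by (metis zero_le_square not_one_le_zero neg_0_le_iff_le)
qed

section \<open>Pairs with \<open>(A\<^sup>2 + 1) (B\<^sup>2 + 1)\<close> a square\<close>

lemma pell_x_diff:
  assumes "n \<le> m"
  shows "pell_x c d m * pell_x c d n - (c\<^sup>2 + d) * pell_y c d m * pell_y c d n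
      = (- d) ^ n * pell_x c d (m - n)"
proof -
  have m: "m = n + (m - n)" using assms by simp
  have "pell_x c d (n + k) * pell_x c d n - (c\<^sup>2 + d) * pell_y c d (n + k) * pell_y c d n
      = (- d) ^ n * pell_x c d k" for k
    unfolding pell_norm[of c d n, symmetric] by (simp add: pell_add power2_eq_square algebra_simps)
  from this[of "m - n"] show ?thesis using m by simp
qed

lemma abs_pell_x_diff:
  fixes c :: int
  assumes "c > 0"
  shows "\<exists>k. (k + n = m \<or> k + m = n) \<and>
    \<bar>pell_x c 1 m * pell_x c 1 n - (c\<^sup>2 + 1) * pell_y c 1 m * pell_y c 1 n\<bar> = pell_x c 1 k"
proof -
  have *: "\<bar>pell_x c 1 m * pell_x c 1 n - (c\<^sup>2 + 1) * pell_y c 1 m * pell_y c 1 n\<bar> = pell_x c 1 (m - n)"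
    if "n \<le> m" for m n
    using pell_x_diff[OF that, of c 1] pell_pos(1)[OF assms, of "m - n"] by (simp add: abs_mult power_abs)
  show ?thesis
  proof (cases "n \<le> m")
    case True thus ?thesis using *[OF True] by (intro exI[of _ "m - n"]) simp
  next
    case False
    hence "m \<le> n" by simp
    from *[OF this] this show ?thesis by (intro exI[of _ "n - m"]) (simp add: mult_ac)
  qed
qed

lemma square_plus_one_not_square:
  fixes a w :: int
  assumes "a > 0" "w\<^sup>2 = a\<^sup>2 + 1"
  shows False
proof -
  have "a < \<bar>w\<bar>" by (rule power_less_imp_less_base[where n = 2]) (use assms in auto)
  hence "(a + 1)\<^sup>2 \<le> \<bar>w\<bar>\<^sup>2" using assms(1) by (intro power_mono) auto
  thus False using assms by (simp add: power2_eq_square algebra_simps)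
qed

text \<open>
  One step of the Euclidean algorithm. With \<open>A = sinh \<alpha>\<close>, \<open>B = sinh \<beta>\<close> and \<open>z = cosh \<alpha> cosh \<beta>\<close>, the new entry is
  \<open>C = \<bar>sinh (\<beta> - 2 \<alpha>)\<bar>\<close>, which lies below \<open>sinh \<beta>\<close> because \<open>0 < \<alpha> < \<beta>\<close>. The last conclusion undoes
  the step.
\<close>
lemma square_pair_descent:
  fixes A B z :: int
  assumes "0 < A" "A < B" "(A\<^sup>2 + 1) * (B\<^sup>2 + 1) = z\<^sup>2" "z > 0"
  obtains C w where "0 < C" "C < B" "(A\<^sup>2 + 1) * (C\<^sup>2 + 1) = w\<^sup>2" "gcd A C = gcd A B"
    "B = C * (2 * A\<^sup>2 + 1) + 2 * A * w \<or> B = - C * (2 * A\<^sup>2 + 1) + 2 * A * w"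
proof -
  define C' where "C' = B * (2 * A\<^sup>2 + 1) - 2 * A * z"
  define w where "w = z * (2 * A\<^sup>2 + 1) - 2 * A * B * (A\<^sup>2 + 1)"
  have w: "(A\<^sup>2 + 1) * (C'\<^sup>2 + 1) = w\<^sup>2"
  proof -
    have "w\<^sup>2 - (A\<^sup>2 + 1) * C'\<^sup>2 = z\<^sup>2 - (A\<^sup>2 + 1) * B\<^sup>2"
      unfolding w_def C'_def by (simp add: power2_eq_square algebra_simps)
    thus ?thesis using assms(3) by (simp add: algebra_simps)
  qed
  have B: "B = C' * (2 * A\<^sup>2 + 1) + 2 * A * w"
    unfolding w_def C'_def by (simp add: power2_eq_square algebra_simps)
  have ne: "C' \<noteq> 0"
  proof
    assume "C' = 0"
    hence "w\<^sup>2 = A\<^sup>2 + 1" using w by simp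
    thus False using square_plus_one_not_square assms(1) by blast
  qed
  have "C' < B"
  proof -
    have "A * B < z"
      by (rule power_less_imp_less_base[where n = 2])
         (use assms in \<open>simp_all add: assms(3)[symmetric] power_mult_distrib algebra_simps add_pos_nonneg\<close>)
    hence "2 * A * (A * B) < 2 * A * z" using assms(1) by (intro mult_strict_left_mono) auto
    thus ?thesis by (simp add: C'_def power2_eq_square algebra_simps)
  qed
  moreover have "- B < C'"
  proof -
    have "A * z < B * (A\<^sup>2 + 1)"
    proof (rule power_less_imp_less_base[where n = 2])
      have "A\<^sup>2 < B\<^sup>2" using assms by (intro power_strict_mono) auto
      hence "A\<^sup>2 * (B\<^sup>2 + 1) < B\<^sup>2 * (A\<^sup>2 + 1)" by (simp add: algebra_simps)
      hence "A\<^sup>2 * (B\<^sup>2 + 1) * (A\<^sup>2 + 1) < B\<^sup>2 * (A\<^sup>2 + 1) * (A\<^sup>2 + 1)"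
        by (intro mult_strict_right_mono) (auto simp: add_nonneg_pos)
      also have "A\<^sup>2 * (B\<^sup>2 + 1) * (A\<^sup>2 + 1) = (A * z)\<^sup>2"
        unfolding power_mult_distrib assms(3)[symmetric] by (simp add: algebra_simps)
      also have "B\<^sup>2 * (A\<^sup>2 + 1) * (A\<^sup>2 + 1) = (B * (A\<^sup>2 + 1))\<^sup>2"
        by (simp add: power2_eq_square)
      finally show "(A * z)\<^sup>2 < (B * (A\<^sup>2 + 1))\<^sup>2" .
    qed (use assms in auto)
    hence "2 * (A * z) < 2 * (B * (A\<^sup>2 + 1))" by simp
    thus ?thesis by (simp add: C'_def power2_eq_square algebra_simps)
  qed
  ultimately have lt: "\<bar>C'\<bar> < B" by linarith
  have g: "gcd A C' = gcd A B"
  proof -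
    have "C' = B + (2 * A * B - 2 * z) * A" by (simp add: C'_def power2_eq_square algebra_simps)
    thus ?thesis using gcd_add_mult[of A "2 * A * B - 2 * z" B] by (simp only: add.commute)
  qed
  have "\<bar>C'\<bar> = C' \<or> \<bar>C'\<bar> = - C'" by linarith
  hence sgn: "B = \<bar>C'\<bar> * (2 * A\<^sup>2 + 1) + 2 * A * w \<or> B = - \<bar>C'\<bar> * (2 * A\<^sup>2 + 1) + 2 * A * w"
    using B by (elim disjE) simp_all
  show thesis
  proof (rule that[of "\<bar>C'\<bar>" w])
    show "(A\<^sup>2 + 1) * (\<bar>C'\<bar>\<^sup>2 + 1) = w\<^sup>2" using w by (simp only: power2_abs)
    show "gcd A \<bar>C'\<bar> = gcd A B" using g by simp
  qed (use ne lt sgn in simp_all)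
qed

text \<open>
  Undoing a step of the algorithm replaces the index \<open>j\<close> by \<open>2 i + j\<close> or \<open>\<bar>2 i - j\<bar>\<close>, according to the signs.
\<close>
lemma square_pair_step:
  fixes c :: int
  assumes "c > 0" "odd i" "odd j" "coprime i j" "A = pell_x c 1 i" "C = pell_x c 1 j"
    and w: "(A\<^sup>2 + 1) * (C\<^sup>2 + 1) = w\<^sup>2"
    and B: "B = C * (2 * A\<^sup>2 + 1) + 2 * A * w \<or> B = - C * (2 * A\<^sup>2 + 1) + 2 * A * w" "B > 0"
  shows "\<exists>k. odd k \<and> coprime i k \<and> B = pell_x c 1 k"
proof -
  let ?D = "c\<^sup>2 + 1"
  have D: "A\<^sup>2 + 1 = ?D * (pell_y c 1 i)\<^sup>2" "C\<^sup>2 + 1 = ?D * (pell_y c 1 j)\<^sup>2"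
    unfolding assms(5,6) by (rule pell_norm_odd, fact)+
  have "w\<^sup>2 = (?D * pell_y c 1 i * pell_y c 1 j)\<^sup>2"
    unfolding w[symmetric] D by (simp add: power2_eq_square mult_ac)
  hence w': "w = ?D * pell_y c 1 i * pell_y c 1 j \<or> w = - (?D * pell_y c 1 i * pell_y c 1 j)"
    by (simp only: power2_eq_iff)
  have "pell_x c 1 (2 * i) = A\<^sup>2 + ?D * (pell_y c 1 i)\<^sup>2"
    by (simp only: mult_2 pell_add assms(5) power2_eq_square mult.assoc)
  hence x2: "pell_x c 1 (2 * i) = 2 * A\<^sup>2 + 1" using D(1) by linarith
  have y2: "pell_y c 1 (2 * i) = 2 * A * pell_y c 1 i"
    unfolding mult_2[of i] pell_add(2) assms(5) by simp
  define P Q where "P = pell_x c 1 (2 * i) * pell_x c 1 j"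
    and "Q = ?D * pell_y c 1 (2 * i) * pell_y c 1 j"
  have "P > 0" "Q \<ge> 0" using pell_pos[OF assms(1)] by (simp_all add: P_def Q_def)
  have eqs: "C * (2 * A\<^sup>2 + 1) = P" "2 * A * (?D * pell_y c 1 i * pell_y c 1 j) = Q"
    unfolding P_def Q_def x2 y2 assms(6) by (simp_all only: mult_ac)
  have "2 * A * w = Q \<or> 2 * A * w = - Q" using w' eqs(2) by (elim disjE) simp_all
  moreover have "- C * (2 * A\<^sup>2 + 1) = - P" using eqs(1) by simp
  ultimately have "B = P + Q \<or> B = \<bar>P - Q\<bar>"
    using B \<open>P > 0\<close> \<open>Q \<ge> 0\<close> eqs(1) by linarith
  then consider "B = pell_x c 1 (2 * i + j)" | "B = \<bar>P - Q\<bar>"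
    unfolding P_def Q_def by (simp only: pell_add(1)) blast
  thus ?thesis
  proof cases
    case 1
    moreover have "coprime i (2 * i + j)"
      using assms(4) by (simp only: coprime_iff_gcd_eq_1 gcd_add_mult)
    moreover have "odd (2 * i + j)" using assms(3) by simp
    ultimately show ?thesis by blast
  next
    case 2
    obtain k where k: "k + j = 2 * i \<or> k + 2 * i = j" "B = pell_x c 1 k"
      using abs_pell_x_diff[OF assms(1), of j "2 * i"] 2 unfolding P_def Q_def by metis
    have "coprime i k"
    proof (rule coprimeI)
      fix d assume d: "d dvd i" "d dvd k"
      hence "d dvd 2 * i" by simp
      with k(1) d(2) have "d dvd j" using dvd_add_right_iff[of d k j] by auto
      thus "is_unit d" using d(1) assms(4) coprime_common_divisor by blast
    qed
    moreover have "odd k" using k(1) assms(3) by presburger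
    ultimately show ?thesis using k(2) by blast
  qed
qed

theorem square_pair_param:
  fixes A B z :: int
  assumes "A > 0" "B > 0" "(A\<^sup>2 + 1) * (B\<^sup>2 + 1) = z\<^sup>2"
  shows "\<exists>i j. odd i \<and> odd j \<and> coprime i j
    \<and> A = pell_x (gcd A B) 1 i \<and> B = pell_x (gcd A B) 1 j"
  using assms
proof (induction "nat (A + B)" arbitrary: A B z rule: less_induct)
  case less
  have step: "\<exists>i j. odd i \<and> odd j \<and> coprime i j
      \<and> A' = pell_x (gcd A' B') 1 i \<and> B' = pell_x (gcd A' B') 1 j"
    if st: "0 < A'" "A' < B'" "(A'\<^sup>2 + 1) * (B'\<^sup>2 + 1) = z\<^sup>2" "A' + B' = A + B" for A' B'
  proof -
    have "z \<noteq> 0"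
    proof
      assume "z = 0"
      hence "A'\<^sup>2 + 1 = 0 \<or> B'\<^sup>2 + 1 = 0" using st(3) by simp
      thus False by (smt (verit) zero_le_power2)
    qed
    hence z: "\<bar>z\<bar> > 0" "(A'\<^sup>2 + 1) * (B'\<^sup>2 + 1) = \<bar>z\<bar>\<^sup>2" using st(3) by simp_all
    obtain C w where C: "0 < C" "C < B'" "(A'\<^sup>2 + 1) * (C\<^sup>2 + 1) = w\<^sup>2" "gcd A' C = gcd A' B'"
      "B' = C * (2 * A'\<^sup>2 + 1) + 2 * A' * w \<or> B' = - C * (2 * A'\<^sup>2 + 1) + 2 * A' * w"
      by (rule square_pair_descent[OF st(1,2) z(2,1)])
    have "nat (A' + C) < nat (A + B)" using C st by simp
    from less.hyps[OF this st(1) C(1,3)] obtain i j where ij: "odd i" "odd j" "coprime i j"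
      "A' = pell_x (gcd A' B') 1 i" "C = pell_x (gcd A' B') 1 j" unfolding C(4) by blast
    have "gcd A' B' > 0" using st(1) by (simp add: gcd_pos_int)
    moreover have "B' > 0" using st by linarith
    ultimately obtain k where "odd k" "coprime i k" "B' = pell_x (gcd A' B') 1 k"
      using square_pair_step[OF _ ij C(3,5)] by blast
    thus ?thesis using ij by blast
  qed
  consider "A < B" | "B < A" | "A = B" by linarith
  thus ?case
  proof cases
    case 1 show ?thesis by (rule step[OF less.prems(1) 1 less.prems(3) refl])
  next
    case 2
    have "(B\<^sup>2 + 1) * (A\<^sup>2 + 1) = z\<^sup>2" using less.prems by (simp add: mult.commute)
    from step[OF less.prems(2) 2 this add.commute] obtain i j where "odd i" "odd j" "coprime i j"
      "B = pell_x (gcd A B) 1 i" "A = pell_x (gcd A B) 1 j" unfolding gcd.commute[of B A] by blast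
    thus ?thesis using coprime_commute by blast
  next
    case 3
    thus ?thesis using less.prems by (intro exI[of _ 1]) simp
  qed
qed

section \<open>The coefficients of the odd-index polynomials modulo a prime\<close>

text \<open>
  The recursion behind Legendre's formula for the exponent of \<open>p\<close> in a factorial.
\<close>
lemma fact_mult_prime:
  fixes p :: nat
  assumes p: "prime p" and r: "r < p"
  shows "\<exists>g. fact (p * q + r) = p ^ q * fact q * g \<and> \<not> p dvd g"
  using r
proof (induction q arbitrary: r)
  case 0
  thus ?case using prime_dvd_fact_iff[OF p, of r] by (intro exI[of _ "fact r"]) simp
next
  case (Suc q)
  have top: "\<exists>g. fact (p * Suc q) = p ^ Suc q * fact (Suc q) * g \<and> \<not> p dvd g"
  proof -
    have "p - 1 < p" using prime_gt_0_nat[OF p] by simp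
    from Suc.IH[OF this] obtain g where g: "fact (p * q + (p - 1)) = p ^ q * fact q * g" "\<not> p dvd g"
      by blast
    have "p * Suc q = Suc (p * q + (p - 1))" using prime_gt_0_nat[OF p] by simp
    hence "fact (p * Suc q) = p * Suc q * fact (p * q + (p - 1))" by (metis fact_Suc of_nat_id)
    also have "\<dots> = p ^ Suc q * fact (Suc q) * g" unfolding g(1) by (simp add: algebra_simps)
    finally show ?thesis using g(2) by blast
  qed
  show ?case using Suc.prems
  proof (induction r)
    case 0
    show ?case using top by simp
  next
    case (Suc r)
    then obtain g where g: "fact (p * Suc q + r) = p ^ Suc q * fact (Suc q) * g" "\<not> p dvd g"
      by (metis Suc_lessD)
    have "\<not> p dvd Suc r" using Suc.prems nat_dvd_not_less by blast
    hence "\<not> p dvd p * Suc q + Suc r" using dvd_add_right_iff[of p "p * Suc q" "Suc r"] by (metis dvd_triv_left)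
    hence "\<not> p dvd (p * Suc q + Suc r) * g" using g(2) p prime_dvd_mult_iff by blast
    moreover have "fact (p * Suc q + Suc r) = p ^ Suc q * fact (Suc q) * ((p * Suc q + Suc r) * g)"
    proof -
      have "fact (p * Suc q + Suc r) = (p * Suc q + Suc r) * fact (p * Suc q + r)"
        unfolding add_Suc_right fact_Suc of_nat_id ..
      thus ?thesis unfolding g(1) by (simp only: mult_ac)
    qed
    ultimately show ?case by blast
  qed
qed

lemma fact_prime_part:
  fixes p :: nat
  assumes p: "prime p" and "p > 2"
  shows "\<exists>a g. fact n = p ^ a * g \<and> \<not> p dvd g \<and> 2 * a \<le> n"
proof (induction n rule: less_induct)
  case (less n)
  show ?case
  proof (cases "n = 0")
    case True
    show ?thesis unfolding True by (intro exI[of _ 0] exI[of _ 1]) (use assms in simp)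
  next
    case False
    define q r where "q = n div p" and "r = n mod p"
    have n: "n = p * q + r" "r < p" using assms by (simp_all add: q_def r_def)
    have "q < n" using False assms by (simp add: q_def)
    from less[OF this] obtain a g where a: "fact q = p ^ a * g" "\<not> p dvd g" "2 * a \<le> q" by blast
    obtain g' where g': "fact n = p ^ q * fact q * g'" "\<not> p dvd g'"
      using fact_mult_prime[OF p n(2), of q] n(1) by metis
    have "fact n = p ^ (q + a) * (g * g')" unfolding g'(1) a(1) by (simp only: power_add mult_ac)
    moreover have "\<not> p dvd g * g'" using a g' p prime_dvd_mult_iff by blast
    moreover have "2 * (q + a) \<le> n"
    proof -
      have "3 * q \<le> p * q" using assms(2) by simp
      also have "\<dots> \<le> n" using n(1) by simp
      finally show ?thesis using a(3) by simp
    qed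
    ultimately show ?thesis by blast
  qed
qed

lemma mid_prod_1_dvd: "l \<ge> 1 \<Longrightarrow> mid_prod n 1 dvd mid_prod n l"
  unfolding mid_prod_def by (rule prod_dvd_prod_subset) auto

lemma coeff_pell_poly_1_dvd:
  assumes "l \<ge> 1"
  shows "coeff (pell_poly h) 1 dvd fact (2 * l + 1) * coeff (pell_poly h :: int poly) l"
proof -
  have "(6 :: int) * coeff (pell_poly h) 1 = 4 * (2 * int h + 1) * mid_prod (int h) 1"
    using coeff_pell_poly[of 1 h] by (simp add: eval_nat_numeral)
  hence "coeff (pell_poly h) 1 dvd 4 * (2 * int h + 1) * mid_prod (int h) 1"
    by (metis dvd_triv_right)
  also have "\<dots> dvd 4 ^ l * (2 * int h + 1) * mid_prod (int h) l"
    using assms by (intro mult_dvd_mono mid_prod_1_dvd) (auto simp: dvd_power)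
  finally show ?thesis by (simp only: coeff_pell_poly)
qed

lemma coeff_pell_poly_1_pos: "h \<ge> 1 \<Longrightarrow> coeff (pell_poly h) 1 > (0 :: int)"
proof -
  assume "h \<ge> 1"
  hence "4 * (2 * int h + 1) * mid_prod (int h) 1 > 0" by simp
  thus ?thesis using coeff_pell_poly[of 1 h] by (simp add: eval_nat_numeral)
qed

text \<open>
  In the value at \<open>\<plusminus>\<i> C\<^sup>2\<close> the linear term dominates \<open>p\<close>-adically all later terms of odd degree:
  the denominators \<open>(2 l + 1)!\<close> contribute at most \<open>p\<^sup>l\<close>, whereas \<open>C\<^sup>2\<^sup>l\<close> contributes \<open>p\<^sup>2\<^sup>l\<close>.
\<close>
lemma higher_term_dvd:
  fixes p :: nat and C :: int
  assumes p: "prime p" "p > 2" and "int p dvd C" and "int p ^ m dvd coeff (pell_poly h) 1" and l: "l \<ge> 3"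
  shows "int p ^ Suc m * C\<^sup>2 dvd coeff (pell_poly h) l * C ^ (2 * l)"
proof -
  obtain a g where a: "fact (2 * l + 1) = p ^ a * g" "\<not> p dvd g" "2 * a \<le> 2 * l + 1"
    using fact_prime_part[OF p] by blast
  let ?c = "coeff (pell_poly h) l :: int"
  have f: "(fact (2 * l + 1) :: int) = int p ^ a * int g"
    using arg_cong[OF a(1), of int] by (simp only: of_nat_fact of_nat_mult of_nat_power)
  have "int p ^ m dvd int g * (int p ^ a * ?c)"
    using dvd_trans[OF assms(4) coeff_pell_poly_1_dvd[of l h]] l unfolding f by (simp add: mult_ac)
  moreover have "coprime (int p ^ m) (int g)"
  proof -
    have "coprime p g" using p(1) a(2) by (rule prime_imp_coprime)
    hence "coprime (int p) (int g)" by simp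
    thus ?thesis by (rule coprime_power_left_iff[THEN iffD2, OF disjI1])
  qed
  ultimately have "int p ^ m dvd int p ^ a * ?c" by (simp only: coprime_dvd_mult_right_iff)
  hence "int p * int p ^ m dvd int p * (int p ^ a * ?c)" by (rule mult_dvd_mono[OF dvd_refl])
  hence "int p ^ Suc m dvd ?c * int p ^ Suc a" by (simp add: mult_ac)
  also have "\<dots> dvd ?c * C ^ (2 * l - 2)"
  proof (rule mult_dvd_mono[OF dvd_refl])
    have "int p ^ Suc a dvd int p ^ (2 * l - 2)" using a(3) l by (intro le_imp_power_dvd) simp
    also have "\<dots> dvd C ^ (2 * l - 2)" using assms(3) by (rule dvd_power_same)
    finally show "int p ^ Suc a dvd C ^ (2 * l - 2)" .
  qed
  finally have "int p ^ Suc m * C\<^sup>2 dvd ?c * C ^ (2 * l - 2) * C\<^sup>2" by (rule mult_dvd_mono) simp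
  also have "?c * C ^ (2 * l - 2) * C\<^sup>2 = ?c * C ^ (2 * l)"
  proof -
    have "2 * l = (2 * l - 2) + 2" using l by simp
    hence "C ^ (2 * l) = C ^ (2 * l - 2) * C\<^sup>2" by (metis power_add)
    thus ?thesis by simp
  qed
  finally show ?thesis .
qed

lemma minus_ii_power: "(- \<i>) ^ (2 * k) = (-1) ^ k" "(- \<i>) ^ Suc (2 * k) = - ((-1) ^ k * \<i>)"
  by (simp_all add: power_mult)

text \<open>
  Only terms of odd degree contribute to the imaginary part, and the linear one is not
  cancelled by the others.
\<close>
lemma Im_pell_poly_nonzero:
  fixes p :: nat and C :: int
  assumes p: "prime p" "p > 2" and "int p dvd C" "C \<noteq> 0" and h: "h \<ge> 1"
  shows "Im (poly (pell_poly h) (- \<i> * of_int (C\<^sup>2))) \<noteq> 0"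
proof
  define c where "c l = (coeff (pell_poly h) l :: int)" for l
  define m where "m = multiplicity (int p) (c 1)"
  have c1: "c 1 \<noteq> 0" using coeff_pell_poly_1_pos[OF h] by (simp add: c_def)
  have pp: "prime (int p)" using p by simp
  have m: "int p ^ m dvd c 1" "\<not> int p ^ Suc m dvd c 1"
  proof -
    have "int p ^ n dvd c 1 \<longleftrightarrow> n \<le> m" for n
      unfolding m_def using c1 pp not_prime_unit by (intro power_dvd_iff_le_multiplicity) blast+
    from this[of m] this[of "Suc m"] show "int p ^ m dvd c 1" "\<not> int p ^ Suc m dvd c 1"
      by linarith+
  qed
  have im_term: "\<exists>k. Im (of_int (c l) * (- \<i> * of_int (C\<^sup>2)) ^ l)
      = of_int (int p ^ Suc m * C\<^sup>2 * k - (if l = 1 then c 1 * C\<^sup>2 else 0))" for l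
  proof -
    have z: "(- \<i> * of_int (C\<^sup>2)) ^ l = (- \<i>) ^ l * of_int (C ^ (2 * l))"
      by (simp only: power_mult_distrib of_int_power power_mult)
    show ?thesis
    proof (cases "even l")
      case True
      then obtain k where k: "l = 2 * k" by blast
      have "Im (of_int (c l) * (- \<i> * of_int (C\<^sup>2)) ^ l) = Im (of_int (c l * (-1) ^ k * C ^ (2 * l)))"
        unfolding z unfolding k minus_ii_power by simp
      also have "\<dots> = 0" by (simp only: complex_Im_of_int)
      finally show ?thesis using k by (intro exI[of _ 0]) auto
    next
      case False
      then obtain k where k: "l = Suc (2 * k)" by (metis oddE Suc_eq_plus1)
      have "of_int (c l) * (- \<i> * of_int (C\<^sup>2)) ^ l
          = of_int (- ((-1) ^ k) * (c l * C ^ (2 * l))) * \<i>"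
        unfolding z unfolding k minus_ii_power by simp
      hence e: "Im (of_int (c l) * (- \<i> * of_int (C\<^sup>2)) ^ l) = of_int (- ((-1) ^ k) * (c l * C ^ (2 * l)))"
        by simp
      show ?thesis
      proof (cases "k = 0")
        case True
        have "- ((-1) ^ k) * (c l * C ^ (2 * l))
            = int p ^ Suc m * C\<^sup>2 * 0 - (if l = 1 then c 1 * C\<^sup>2 else 0)"
          using True k by simp
        thus ?thesis unfolding e by (intro exI[of _ 0]) (simp only:)
      next
        case False
        hence "l \<ge> 3" using k by simp
        from higher_term_dvd[OF p assms(3) m(1)[unfolded c_def] this]
        obtain q where "c l * C ^ (2 * l) = int p ^ Suc m * C\<^sup>2 * q" unfolding c_def by blast
        hence "- ((-1) ^ k) * (c l * C ^ (2 * l))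
            = int p ^ Suc m * C\<^sup>2 * (- ((-1) ^ k) * q) - (if l = 1 then c 1 * C\<^sup>2 else 0)"
          using \<open>l \<ge> 3\<close> by simp
        thus ?thesis unfolding e by (intro exI[of _ "- ((-1) ^ k) * q"]) (simp only:)
      qed
    qed
  qed
  then obtain K where K: "\<And>l. Im (of_int (c l) * (- \<i> * of_int (C\<^sup>2)) ^ l)
      = of_int (int p ^ Suc m * C\<^sup>2 * K l - (if l = 1 then c 1 * C\<^sup>2 else 0))" by metis
  have "Im (poly (pell_poly h) (- \<i> * of_int (C\<^sup>2)))
      = (\<Sum>l\<le>h. of_int (int p ^ Suc m * C\<^sup>2 * K l - (if l = 1 then c 1 * C\<^sup>2 else 0)))"
    unfolding poly_pell_poly Im_sum c_def[symmetric] K ..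
  also have "\<dots> = of_int (int p ^ Suc m * C\<^sup>2 * (\<Sum>l\<le>h. K l) - c 1 * C\<^sup>2)"
    unfolding of_int_sum[symmetric] sum_subtractf sum_distrib_left[symmetric]
    using h by (simp add: sum.delta)
  finally have im: "Im (poly (pell_poly h) (- \<i> * of_int (C\<^sup>2)))
      = of_int (C\<^sup>2 * (int p ^ Suc m * (\<Sum>l\<le>h. K l) - c 1))" by (simp add: algebra_simps)
  assume "Im (poly (pell_poly h) (- \<i> * of_int (C\<^sup>2))) = 0"
  with im have "C\<^sup>2 * (int p ^ Suc m * (\<Sum>l\<le>h. K l) - c 1) = 0" by (simp only: of_int_eq_0_iff)
  hence "c 1 = int p ^ Suc m * (\<Sum>l\<le>h. K l)" using assms(4) by simp
  with m(2) show False by (metis dvd_triv_left)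
qed

lemma lead_coeff_pell_poly: "coeff (pell_poly h) h = (4 ^ h :: int)"
  by (induction h rule: pell_poly.induct) (simp_all add: coeff_pell_poly_eq_0)

text \<open>
  For \<open>p = 2 h + 1\<close> all coefficients of \<open>pell_poly h\<close> except the leading one, \<open>4\<^sup>h\<close>, are divisible by \<open>p\<close>.
\<close>
lemma prime_not_dvd_pell_w:
  fixes p :: nat
  assumes p: "prime p" "p > 2" and "\<not> int p dvd C"
  shows "\<not> int p dvd pell_w C p"
proof
  assume dvd: "int p dvd pell_w C p"
  have "odd p" using p prime_odd_nat by blast
  then obtain h where h: "p = 2 * h + 1" by (rule oddE)
  define c where "c l = (coeff (pell_poly h) l :: int)" for l
  have pp: "prime (int p)" using p by simp
  have "int p dvd c l" if "l < h" for l
  proof -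
    have "int p dvd 4 ^ l * (2 * int h + 1) * mid_prod (int h) l"
      unfolding h of_nat_add of_nat_mult by (intro dvd_mult2[OF dvd_mult]) simp
    hence "int p dvd fact (2 * l + 1) * c l" unfolding c_def coeff_pell_poly .
    moreover have "\<not> int p dvd fact (2 * l + 1)"
      using prime_dvd_fact_iff[OF p(1), of "2 * l + 1"] that h
      by (metis of_nat_fact int_dvd_int_iff add_less_cancel_right mult_less_cancel2 mult.commute
          not_le zero_less_numeral)
    ultimately show ?thesis using pp prime_dvd_mult_iff by blast
  qed
  hence low: "int p dvd (\<Sum>l<h. c l * (C\<^sup>2) ^ l)" by (intro dvd_sum dvd_mult2) simp
  have "pell_w C p = (\<Sum>l\<le>h. c l * (C\<^sup>2) ^ l)"
    unfolding pell_w_def poly_pell_poly c_def h by simp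
  also have "\<dots> = (\<Sum>l<h. c l * (C\<^sup>2) ^ l) + 4 ^ h * (C\<^sup>2) ^ h"
    by (simp add: lessThan_Suc_atMost[symmetric] c_def lead_coeff_pell_poly)
  finally have "int p dvd 4 ^ h * (C\<^sup>2) ^ h" using dvd low by (simp add: dvd_add_right_iff)
  hence "int p dvd 4 \<or> int p dvd C" using pp prime_dvd_mult_iff prime_dvd_power by metis
  hence "int p dvd 2 ^ 2" using assms(3) by simp
  hence "int p dvd 2" using pp prime_dvd_power by blast
  thus False using p(2) zdvd_imp_le by fastforce
qed

section \<open>A Pell equation over the Gaussian integers\<close>

definition gaussian :: "complex \<Rightarrow> bool" where
  "gaussian z \<longleftrightarrow> Re z \<in> \<int> \<and> Im z \<in> \<int>"

lemma gaussian_intros [intro, simp]: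
  "gaussian (of_int k)" "gaussian \<i>" "gaussian 0" "gaussian 1"
  "gaussian z \<Longrightarrow> gaussian w \<Longrightarrow> gaussian (z + w)"
  "gaussian z \<Longrightarrow> gaussian w \<Longrightarrow> gaussian (z - w)"
  "gaussian z \<Longrightarrow> gaussian w \<Longrightarrow> gaussian (z * w)"
  "gaussian z \<Longrightarrow> gaussian (- z)"
  by (simp_all add: gaussian_def)

lemma gaussian_norm_ge_1:
  assumes "gaussian z" "z \<noteq> 0"
  shows "norm z \<ge> 1"
proof -
  have "\<bar>Re z\<bar> \<ge> 1 \<or> \<bar>Im z\<bar> \<ge> 1"
    using assms Ints_nonzero_abs_ge1 by (auto simp: gaussian_def complex_eq_iff)
  thus ?thesis using abs_Re_le_cmod[of z] abs_Im_le_cmod[of z] by linarith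
qed

lemma gaussian_unit_cases:
  assumes "gaussian u" "norm u = 1"
  shows "u \<in> {1, -1, \<i>, -\<i>}"
proof -
  from assms(1) obtain a b where ab: "Re u = of_int a" "Im u = of_int b"
    by (auto simp: gaussian_def elim!: Ints_cases)
  have "(Re u)\<^sup>2 + (Im u)\<^sup>2 = 1" using assms(2) by (simp add: cmod_power2[symmetric])
  hence "of_int (a\<^sup>2 + b\<^sup>2) = (of_int 1 :: real)" unfolding ab by simp
  hence sum: "a\<^sup>2 + b\<^sup>2 = 1" by (simp only: of_int_eq_iff)
  have "a\<^sup>2 = 0 \<or> a\<^sup>2 = 1" using sum zero_le_power2[of a] zero_le_power2[of b] by linarith
  hence "(a = 0 \<and> (b = 1 \<or> b = -1)) \<or> ((a = 1 \<or> a = -1) \<and> b = 0)"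
    using sum by (auto simp: power2_eq_1_iff)
  thus ?thesis using ab by (auto simp: complex_eq_iff)
qed

text \<open>
  Multiplying a solution \<open>X + Y \<surd>D\<close> by \<open>C - \<surd>D\<close>, up to the sign of \<open>Y\<close>, makes \<open>\<bar>Y\<bar>\<close> smaller by at
  least \<open>1/3\<close>: the product of the two candidates \<open>X - C Y\<close> and \<open>X + C Y\<close> for the new \<open>Y\<close> is
  \<open>\<i> Y\<^sup>2\<close> plus a unit, and the larger one has absolute value at least \<open>C \<bar>Y\<bar>\<close>.
\<close>
lemma gaussian_descent_bound:
  fixes C :: int and X Y :: complex
  assumes "C \<ge> 3" "norm (X\<^sup>2 - ((of_int C)\<^sup>2 + \<i>) * Y\<^sup>2) = 1" "norm Y \<ge> 1"
    and le: "norm (X - of_int C * Y) \<le> norm (X + of_int C * Y)"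
  shows "norm (of_int C * Y - X) \<le> norm Y - 1 / 3"
proof -
  let ?c = "of_int C :: complex"
  define s where "s = norm (X - ?c * Y)"
  define y where "y = norm Y"
  have y: "y \<ge> 1" using assms(3) by (simp add: y_def)
  have s: "s \<ge> 0" by (simp add: s_def)
  have "2 * real_of_int C * y = norm ((X + ?c * Y) - (X - ?c * Y))"
    using assms(1) by (simp add: y_def norm_mult)
  also have "\<dots> \<le> norm (X + ?c * Y) + s" unfolding s_def by (rule norm_triangle_ineq4)
  also have "\<dots> \<le> 2 * norm (X + ?c * Y)" using le by (simp add: s_def)
  finally have big: "real_of_int C * y \<le> norm (X + ?c * Y)" by simp
  have "3 * y \<le> real_of_int C * y" using assms(1) y by (intro mult_right_mono) auto
  hence "s * (3 * y) \<le> s * norm (X + ?c * Y)" using big s by (intro mult_left_mono) auto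
  also have "\<dots> = norm ((X - ?c * Y) * (X + ?c * Y))" by (simp add: s_def norm_mult)
  also have "(X - ?c * Y) * (X + ?c * Y) = (X\<^sup>2 - (?c\<^sup>2 + \<i>) * Y\<^sup>2) + \<i> * Y\<^sup>2"
    by (simp add: power2_eq_square algebra_simps)
  also have "norm \<dots> \<le> 1 + y\<^sup>2"
    using norm_triangle_ineq[of "X\<^sup>2 - (?c\<^sup>2 + \<i>) * Y\<^sup>2" "\<i> * Y\<^sup>2"] assms(2)
    by (simp add: y_def norm_mult norm_power)
  also have "1 + y\<^sup>2 \<le> (y - 1 / 3) * (3 * y)"
  proof -
    have "1 * 1 \<le> y * y" using y by (intro mult_mono) auto
    moreover have "y * 1 \<le> y * y" using y by (intro mult_left_mono) auto
    ultimately show ?thesis by (simp add: power2_eq_square algebra_simps)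
  qed
  finally have "s \<le> y - 1 / 3" using y by (simp add: mult_le_cancel_right)
  thus ?thesis by (simp add: s_def y_def norm_minus_commute)
qed

text \<open>
  Descent on \<open>\<bar>Y\<bar>\<close>. For a suitable sign of \<open>Y\<close>, the product \<open>X' + Y' \<surd>D\<close> of \<open>X + Y \<surd>D\<close> and \<open>C - \<surd>D\<close> is a smaller solution, and
  multiplying it by \<open>\<i> (C + \<surd>D)\<close> recovers \<open>X + Y \<surd>D\<close>, which moves the exponent by one, up or down
  according to the sign of \<open>Y'\<close>. The norm is only required to be a unit, since it changes by the factor
  \<open>- \<i>\<close> at each step.
\<close>
theorem gaussian_pell:
  fixes C :: int and X Y :: complex
  assumes C: "C \<ge> 3" and "gaussian X" "gaussian Y"
    and "norm (X\<^sup>2 - ((of_int C)\<^sup>2 + \<i>) * Y\<^sup>2) = 1"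
  shows "\<exists>u k. gaussian u \<and> norm u = 1 \<and> X = u * pell_x (of_int C) \<i> k
    \<and> (Y = u * pell_y (of_int C) \<i> k \<or> Y = - u * pell_y (of_int C) \<i> k)"
proof -
  let ?c = "of_int C :: complex"
  let ?D = "?c\<^sup>2 + \<i>"
  let ?x = "pell_x ?c \<i>" and ?y = "pell_y ?c \<i>"
  have "\<forall>X Y. gaussian X \<longrightarrow> gaussian Y \<longrightarrow> norm (X\<^sup>2 - ?D * Y\<^sup>2) = 1 \<longrightarrow> norm Y \<le> real n / 3 \<longrightarrow>
      (\<exists>u k. gaussian u \<and> norm u = 1 \<and> X = u * ?x k \<and> (Y = u * ?y k \<or> Y = - u * ?y k))" for n :: nat
  proof (induction n)
    case 0
    show ?case
    proof (intro allI impI)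
      fix X Y assume *: "gaussian X" "norm (X\<^sup>2 - ?D * Y\<^sup>2) = 1" "norm Y \<le> real 0 / 3"
      hence "Y = 0" by simp
      hence "norm X = 1 \<or> norm X = -1" using * by (simp add: norm_power power2_eq_1_iff)
      hence "norm X = 1" using norm_ge_zero[of X] by linarith
      note * = * this \<open>Y = 0\<close>
      thus "\<exists>u k. gaussian u \<and> norm u = 1 \<and> X = u * ?x k \<and> (Y = u * ?y k \<or> Y = - u * ?y k)"
        using * by (intro exI[of _ X] exI[of _ 0]) simp
    qed
  next
    case (Suc n)
    have main: "\<exists>u k. gaussian u \<and> norm u = 1 \<and> X = u * ?x k \<and> (Y = u * ?y k \<or> Y = - u * ?y k)"
      if XY: "gaussian X" "gaussian Y" "norm (X\<^sup>2 - ?D * Y\<^sup>2) = 1" "norm Y \<le> real (Suc n) / 3"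
        and le: "norm (X - ?c * Y) \<le> norm (X + ?c * Y)" for X Y
    proof (cases "Y = 0")
      case True
      hence "norm Y \<le> real n / 3" by simp
      thus ?thesis using Suc XY by blast
    next
      case False
      define X' Y' where "X' = ?c * X - ?D * Y" and "Y' = ?c * Y - X"
      have g: "gaussian X'" "gaussian Y'"
        unfolding X'_def Y'_def power2_eq_square using XY by simp_all
      have "X'\<^sup>2 - ?D * Y'\<^sup>2 = - \<i> * (X\<^sup>2 - ?D * Y\<^sup>2)"
        unfolding X'_def Y'_def by (simp add: power2_eq_square algebra_simps)
      hence nrm: "norm (X'\<^sup>2 - ?D * Y'\<^sup>2) = 1" using XY(3) by (simp add: norm_mult)
      have "norm Y' \<le> real n / 3"
        using gaussian_descent_bound[OF C XY(3) gaussian_norm_ge_1[OF XY(2) False] le] XY(4)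
        unfolding Y'_def by (simp add: field_simps)
      then obtain u k where uk: "gaussian u" "norm u = 1" "X' = u * ?x k"
        "Y' = u * ?y k \<or> Y' = - u * ?y k"
        using Suc g nrm by blast
      have X: "X = \<i> * (?c * X' + ?D * Y')" and Y: "Y = \<i> * (X' + ?c * Y')"
      proof -
        have "?c * X' + ?D * Y' = - \<i> * X" "X' + ?c * Y' = - \<i> * Y"
          unfolding X'_def Y'_def by (simp_all add: power2_eq_square algebra_simps)
        thus "X = \<i> * (?c * X' + ?D * Y')" "Y = \<i> * (X' + ?c * Y')"
          by (simp_all add: mult.assoc[symmetric])
      qed
      show ?thesis
      proof (cases "Y' = u * ?y k")
        case True
        have "X = (\<i> * u) * ?x (Suc k)" "Y = (\<i> * u) * ?y (Suc k)"
          unfolding X Y True uk(3) by (simp_all add: algebra_simps)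
        moreover have "gaussian (\<i> * u)" "norm (\<i> * u) = 1" using uk by (simp_all add: norm_mult)
        ultimately show ?thesis by blast
      next
        case False
        hence Y': "Y' = - u * ?y k" "k \<noteq> 0" using uk(4) by (auto intro: ccontr)
        obtain m where m: "k = Suc m" using Y'(2) not0_implies_Suc by blast
        have x: "?c * ?x k - ?D * ?y k = - \<i> * ?x m" and y: "?x k - ?c * ?y k = \<i> * ?y m"
          unfolding m by (simp_all add: power2_eq_square algebra_simps)
        have "X = \<i> * (u * (?c * ?x k - ?D * ?y k))" "Y = \<i> * (u * (?x k - ?c * ?y k))"
          unfolding X Y Y'(1) uk(3) by (simp_all add: algebra_simps)
        moreover have ii: "\<i> * (u * (\<i> * w)) = - (u * w)" for w
        proof -
          have "\<i> * (u * (\<i> * w)) = (\<i> * \<i>) * (u * w)" by (simp only: mult_ac)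
          thus ?thesis by simp
        qed
        ultimately have "X = u * ?x m" "Y = - u * ?y m" unfolding x y by (simp_all add: ii)
        thus ?thesis using uk by blast
      qed
    qed
    show ?case
    proof (intro allI impI)
      fix X Y assume XY: "gaussian X" "gaussian Y" "norm (X\<^sup>2 - ?D * Y\<^sup>2) = 1" "norm Y \<le> real (Suc n) / 3"
      show "\<exists>u k. gaussian u \<and> norm u = 1 \<and> X = u * ?x k \<and> (Y = u * ?y k \<or> Y = - u * ?y k)"
      proof (cases "norm (X - ?c * Y) \<le> norm (X + ?c * Y)")
        case True
        thus ?thesis using main XY by blast
      next
        case False
        hence le: "norm (X - ?c * - Y) \<le> norm (X + ?c * - Y)" by simp
        have "gaussian (- Y)" "norm (X\<^sup>2 - ?D * (- Y)\<^sup>2) = 1" "norm (- Y) \<le> real (Suc n) / 3"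
          using XY by simp_all
        from main[OF XY(1) this le] obtain u k where "gaussian u" "norm u = 1" "X = u * ?x k"
          "- Y = u * ?y k \<or> - Y = - u * ?y k" by blast
        moreover from this(4) have "Y = - u * ?y k \<or> Y = u * ?y k"
          by (metis minus_minus mult_minus_left)
        ultimately show ?thesis by blast
      qed
    qed
  qed
  moreover obtain n :: nat where "3 * norm Y \<le> real n" using real_arch_simple by blast
  hence "norm Y \<le> real n / 3" by simp
  ultimately show ?thesis using assms by blast
qed

lemma pell_of_int:
  "pell_x (of_int c) (of_int d) k = (of_int (pell_x c d k) :: 'a::comm_ring_1)"
  "pell_y (of_int c) (of_int d) k = (of_int (pell_y c d k) :: 'a::comm_ring_1)"
  by (induction k) simp_all

text \<open>
  The counterpart for \<open>x\<close> of \<open>1 + cos (n \<phi>) = (1 + cos \<phi>) (cos (n \<phi>/2) / cos (\<phi>/2))\<^sup>2\<close> for odd \<open>n\<close>; the shift by \<open>\<i>\<close>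
  in place of \<open>1\<close> is what makes the residue of \<open>n\<close> modulo \<open>4\<close> relevant.
\<close>
lemma pell_x_plus_ii:
  fixes \<theta> :: complex
  shows "pell_x \<theta> 1 (4 * t + 1) + \<i>
    = (\<theta> + \<i>) * (pell_y \<theta> 1 (2 * t + 1) - \<i> * pell_y \<theta> 1 (2 * t))\<^sup>2"
proof -
  define X Y where "X = pell_x \<theta> 1 (2 * t)" and "Y = pell_y \<theta> 1 (2 * t)"
  have norm: "X\<^sup>2 = 1 + (\<theta>\<^sup>2 + 1) * Y\<^sup>2"
  proof -
    have "X\<^sup>2 - (\<theta>\<^sup>2 + 1) * Y\<^sup>2 = 1"
      using pell_norm[of \<theta> 1 "2 * t"] by (simp add: X_def Y_def)
    thus ?thesis by (simp add: algebra_simps)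
  qed
  have idx: "4 * t + 1 = 2 * t + Suc (2 * t)" by simp
  have lhs: "pell_x \<theta> 1 (4 * t + 1) = \<theta> * X\<^sup>2 + (\<theta>\<^sup>2 + 1) * (2 * X * Y + \<theta> * Y\<^sup>2)"
    unfolding idx pell_add(1) pell_x.simps pell_y.simps X_def[symmetric] Y_def[symmetric]
    by (simp add: power2_eq_square algebra_simps)
  have "pell_y \<theta> 1 (2 * t + 1) = X + \<theta> * Y" by (simp add: X_def Y_def)
  hence rhs: "(\<theta> + \<i>) * (pell_y \<theta> 1 (2 * t + 1) - \<i> * pell_y \<theta> 1 (2 * t))\<^sup>2
      = \<theta> * X\<^sup>2 + (\<theta>\<^sup>2 + 1) * (2 * X * Y + \<theta> * Y\<^sup>2) + \<i> * (X\<^sup>2 - (\<theta>\<^sup>2 + 1) * Y\<^sup>2)"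
    unfolding Y_def[symmetric] by (simp add: power2_eq_square algebra_simps)
  show ?thesis unfolding lhs rhs by (simp add: norm)
qed

text \<open>
  \<open>B\<^sup>2 + \<i> = (C\<^sup>2 + \<i>) s\<^sup>2\<close> makes \<open>B\<close> a unit times \<open>x\<^sub>k\<close> for the base \<open>C + \<surd>(C\<^sup>2 + \<i>)\<close>. Comparing norms fixes the unit
  up to sign, so that \<open>B = \<plusminus> C P\<close> with \<open>P\<close> a value of \<open>pell_poly\<close> at \<open>- \<i> C\<^sup>2\<close>; as \<open>P\<close> is then real, \<open>k = 1\<close>
  and \<open>B = C\<close>, which is too small.
\<close>
theorem pell_x_of_square_not_square:
  fixes p :: nat and C B :: int
  assumes p: "prime p" "p > 2" "int p dvd C" and "C > 0" "B > 0" "t \<ge> 1"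
    and B: "pell_x (C\<^sup>2) 1 (4 * t + 1) = B\<^sup>2"
  shows False
proof -
  let ?c = "of_int C :: complex"
  have C3: "C \<ge> 3" using zdvd_imp_le[OF p(3) \<open>C > 0\<close>] p(2) by linarith
  define s where "s = of_int (pell_y (C\<^sup>2) 1 (2 * t + 1)) - \<i> * of_int (pell_y (C\<^sup>2) 1 (2 * t))"
  have "(of_int B)\<^sup>2 + \<i> = (?c\<^sup>2 + \<i>) * s\<^sup>2"
    using pell_x_plus_ii[of "of_int (C\<^sup>2)" t]
    unfolding pell_of_int[of "C\<^sup>2" 1, unfolded of_int_1] B s_def[symmetric] by simp
  hence norm: "(of_int B)\<^sup>2 - (?c\<^sup>2 + \<i>) * s\<^sup>2 = - \<i>" by (simp add: algebra_simps)
  have "gaussian s" unfolding s_def by (intro gaussian_intros)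
  then obtain u k where u: "gaussian u" "norm u = 1" and X: "of_int B = u * pell_x ?c \<i> k"
    and Y: "s = u * pell_y ?c \<i> k \<or> s = - u * pell_y ?c \<i> k"
    using gaussian_pell[OF C3 gaussian_intros(1)[of B], of s] unfolding norm by auto
  \<comment> \<open>the norm of \<open>B + s \<surd>(C\<^sup>2 + \<i>)\<close>, computed in two ways\<close>
  have "u\<^sup>2 * (- \<i>) ^ k = u\<^sup>2 * ((pell_x ?c \<i> k)\<^sup>2 - (?c\<^sup>2 + \<i>) * (pell_y ?c \<i> k)\<^sup>2)"
    by (simp only: pell_norm)
  also have "\<dots> = (u * pell_x ?c \<i> k)\<^sup>2 - (?c\<^sup>2 + \<i>) * (u * pell_y ?c \<i> k)\<^sup>2"
    by (simp add: power_mult_distrib algebra_simps)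
  also have "(u * pell_y ?c \<i> k)\<^sup>2 = s\<^sup>2" using Y by auto
  finally have unit: "u\<^sup>2 * (- \<i>) ^ k = - \<i>" using norm X by simp
  have u4: "u\<^sup>2 = 1 \<or> u\<^sup>2 = -1" using gaussian_unit_cases[OF u] by auto
  have "odd k"
  proof
    assume "even k"
    then obtain h where "k = 2 * h" by blast
    hence "u\<^sup>2 * (-1) ^ h = - \<i>" using unit minus_ii_power(1)[of h] by simp
    moreover have "(-1 :: complex) ^ h = 1 \<or> (-1 :: complex) ^ h = -1" by (cases "even h") auto
    ultimately show False using u4 by (auto simp: complex_eq_iff)
  qed
  then obtain h where k: "k = 2 * h + 1" by (rule oddE)
  have u2: "u\<^sup>2 = (-1) ^ h"
  proof -
    have "u\<^sup>2 * (- ((-1) ^ h * \<i>)) = - \<i>" using unit minus_ii_power(2)[of h] k by simp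
    hence "u\<^sup>2 * (-1) ^ h = 1" by simp
    moreover have "(-1 :: complex) ^ h = 1 \<or> (-1 :: complex) ^ h = -1" by (cases "even h") auto
    ultimately show ?thesis by (metis minus_minus mult.right_neutral mult_minus_right)
  qed
  define P where "P = poly (pell_poly h) (- \<i> * of_int (C\<^sup>2))"
  have "(u * \<i> ^ h)\<^sup>2 = (-1) ^ h * (-1) ^ h"
    unfolding power_mult_distrib u2 by (simp flip: power_mult add: mult.commute[of h])
  hence "(u * \<i> ^ h)\<^sup>2 = 1" by (simp flip: power_mult_distrib)
  hence sgn: "u * \<i> ^ h = 1 \<or> u * \<i> ^ h = -1" by (simp only: power2_eq_1_iff)
  have "pell_x ?c \<i> k = ?c * \<i> ^ h * P"
    unfolding k P_def using pell_x_poly[of \<i> "- \<i>" ?c h] by simp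
  hence BP: "of_int B = ?c * (u * \<i> ^ h) * P" using X by simp
  hence BP': "of_int B = ?c * P \<or> of_int B = - (?c * P)" using sgn by (elim disjE) simp_all
  show False
  proof (cases "h = 0")
    case True
    hence "P = 1" by (simp add: P_def)
    with BP' have "(of_int B :: complex) = of_int C \<or> (of_int B :: complex) = of_int (- C)" by simp
    hence "B = C \<or> B = - C" by (simp only: of_int_eq_iff)
    hence "B = C" using \<open>B > 0\<close> \<open>C > 0\<close> by linarith
    moreover have "pell_x (C\<^sup>2) 1 1 < pell_x (C\<^sup>2) 1 (4 * t + 1)"
      by (rule pell_x_less) (use \<open>C > 0\<close> \<open>t \<ge> 1\<close> in simp_all)
    ultimately show False using B by simp
  next
    case False
    have "Im (of_int B :: complex) = Im (?c * P) \<or> Im (of_int B :: complex) = - Im (?c * P)"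
      using BP' by (metis uminus_complex.simps(2))
    hence "Im P = 0" using \<open>C > 0\<close> by auto
    moreover have "Im P \<noteq> 0" unfolding P_def
      using Im_pell_poly_nonzero[OF p] \<open>C > 0\<close> False by simp
    ultimately show False by blast
  qed
qed

section \<open>Squares of the form \<open>x\<^sub>j(c\<^sup>2)\<close>\<close>

lemma coprime_mult_square:
  fixes a b s :: int
  assumes "coprime a b" "a > 0" "b > 0" "a * b = s\<^sup>2"
  shows "\<exists>r>0. a = r\<^sup>2"
proof -
  have "int (nat a * nat b) = int ((nat \<bar>s\<bar>)\<^sup>2)" using assms by simp
  hence "nat a * nat b = (nat \<bar>s\<bar>)\<^sup>2" by (simp only: of_nat_eq_iff)
  moreover have "coprime (nat a) (nat b)" using assms by (simp add: coprime_int_iff[symmetric])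
  ultimately have "is_nth_power 2 (nat a)"
    using is_nth_power_mult_coprime_natD(1)[of "nat a" "nat b" 2] assms
    by (simp add: is_nth_power_def)
  then obtain r where "nat a = r\<^sup>2" by (auto simp: is_nth_power_def)
  hence "a = (int r)\<^sup>2" "r \<noteq> 0" using assms(2) by (auto simp: nat_eq_iff intro!: Nat.gr0I)
  thus ?thesis by (intro exI[of _ "int r"]) simp
qed

text \<open>
  The value is \<open>p\<close> modulo \<open>4 C\<^sup>2\<close>, and \<open>C\<^sup>2\<close> is divisible by \<open>p C\<close>.
\<close>
lemma pell_w_prime_part:
  fixes p :: nat
  assumes "odd p" "int p dvd C"
  shows "\<exists>e. pell_w C p = int p * e \<and> coprime e C"
proof -
  obtain t where t: "pell_w C p - int p = 4 * C\<^sup>2 * t" using pell_w_cong[OF assms(1), of C] by blast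
  obtain k where k: "C = int p * k" using assms(2) by blast
  have "pell_w C p = int p * (1 + C * (4 * k * t))"
    using t k by (simp add: power2_eq_square algebra_simps)
  moreover have "coprime (1 + C * (4 * k * t)) C"
    by (metis coprime_1_left coprime_iff_gcd_eq_1 gcd.commute gcd_add_mult add.commute mult.commute)
  ultimately show ?thesis by blast
qed

text \<open>
  The index \<open>j\<close> is a square, say \<open>j = p\<^sup>2 k\<close> with \<open>p\<close> prime. Let \<open>C = x\<^sub>k\<close> and \<open>D = x\<^sub>p\<^sub>k\<close>, so that \<open>B\<^sup>2\<close> is \<open>D\<close> times
  \<open>x\<^sub>p(D) / D\<close>. If \<open>p\<close> did not divide \<open>D\<close>, these factors would be coprime, hence squares, and \<open>p\<close> would be a
  square index. So \<open>p\<close> divides \<open>D\<close> and then \<open>C\<close>; in \<open>B\<^sup>2 = C (x\<^sub>p(C) / C) (x\<^sub>p(D) / D)\<close> the last two factors are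
  \<open>p\<close> times numbers prime to \<open>C\<close>. Therefore \<open>C\<close> is a square, and \<open>pell_x_of_square_not_square\<close> applies
  to the index \<open>p\<^sup>2\<close>.
\<close>
theorem pell_x_square_arg_not_square:
  fixes c B :: int
  assumes c: "c > 0" and j: "odd j" "j > 1" and "B > 0" and B: "pell_x (c\<^sup>2) 1 j = B\<^sup>2"
  shows False
proof -
  have c2: "c\<^sup>2 > 0" using c by simp
  have "c\<^sup>2 * pell_w (c\<^sup>2) j = B\<^sup>2" using B pell_x_eq_w[OF j(1)] by simp
  moreover from this have "c dvd B" by (metis dvd_triv_left pow_divides_pow_iff zero_less_numeral pos2)
  then obtain b where "B = c * b" by blast
  ultimately have "pell_w (c\<^sup>2) j = b\<^sup>2" using c by (simp add: power_mult_distrib)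
  then obtain m where m: "j = m\<^sup>2" using pell_w_square_imp_square[OF c2 j(1)] by blast
  have "m \<noteq> 1" "odd m" using m j by auto
  then obtain p where p: "prime p" "p dvd m" using prime_factor_nat by blast
  have op: "odd p" using p \<open>odd m\<close> dvd_trans by blast
  have p2: "p > 2" using op prime_ge_2_nat[OF p(1)] by (cases "p = 2") auto
  obtain k0 where k0: "m = p * k0" using p(2) by blast
  define k where "k = k0\<^sup>2"
  have jk: "j = p * (p * k)" by (simp add: m k0 k_def power2_eq_square)
  have ok: "odd k" "odd (p * k)" using j(1) unfolding jk by simp_all
  define C where "C = pell_x (c\<^sup>2) 1 k"
  define D where "D = pell_x (c\<^sup>2) 1 (p * k)"
  have pos: "C > 0" "D > 0" unfolding C_def D_def using pell_pos(1)[OF c2] by blast+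
  have D: "D = C * pell_w C p"
    unfolding D_def C_def pell_compose(1)[OF ok(1)] using pell_x_eq_w[OF op] .
  have BD: "B\<^sup>2 = D * pell_w D p"
    unfolding B[symmetric] jk pell_compose(1)[OF ok(2)] D_def[symmetric] using pell_x_eq_w[OF op] .
  have wpos: "pell_w C p > 0" "pell_w D p > 0" using pell_w_pos pos op by blast+
  have pp: "prime (int p)" using p(1) by simp
  have "int p dvd D"
  proof (rule ccontr)
    assume nd: "\<not> int p dvd D"
    have "coprime (pell_w D p) D"
    proof (rule coprimeI)
      fix d assume d: "d dvd pell_w D p" "d dvd D"
      have "d dvd pell_w D p - int p"
        using d(2) pell_w_cong[OF op, of D] by (metis dvd_mult dvd_trans power2_eq_square)
      hence "d dvd int p" using d(1) dvd_diff_right_iff by blast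
      moreover have "coprime (int p) D" using pp nd by (rule prime_imp_coprime)
      ultimately show "is_unit d" using d(2) coprime_common_divisor by blast
    qed
    then obtain r where "pell_w D p = r\<^sup>2"
      using coprime_mult_square[of "pell_w D p" D B] BD pos wpos by (auto simp: mult.commute)
    then obtain n where "p = n\<^sup>2" using pell_w_square_imp_square[OF pos(2) op] by blast
    thus False using p(1) by (simp add: prime_power_iff)
  qed
  have pC: "int p dvd C"
  proof (rule ccontr)
    assume "\<not> int p dvd C"
    moreover from this have "\<not> int p dvd pell_w C p" by (rule prime_not_dvd_pell_w[OF p(1) p2])
    ultimately show False using \<open>int p dvd D\<close> pp unfolding D by (simp add: prime_dvd_mult_iff)
  qed
  obtain e where e: "pell_w C p = int p * e" "coprime e C" using pell_w_prime_part[OF op pC] by blast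
  obtain f where f: "pell_w D p = int p * f" "coprime f D"
    using pell_w_prime_part[OF op \<open>int p dvd D\<close>] by blast
  have ef: "e > 0" "f > 0" using wpos e(1) f(1) by (simp_all add: zero_less_mult_iff)
  have BC: "B\<^sup>2 = (int p)\<^sup>2 * (C * (e * f))"
  proof -
    have "D = C * (int p * e)" using D unfolding e(1) .
    moreover have "B\<^sup>2 = D * (int p * f)" using BD unfolding f(1) .
    ultimately show ?thesis by (simp only: power2_eq_square mult_ac)
  qed
  hence "int p dvd B" by (metis dvd_triv_left pow_divides_pow_iff zero_less_numeral pos2)
  then obtain b where b: "B = int p * b" by blast
  have "C * (e * f) = b\<^sup>2" using BC p2 unfolding b power_mult_distrib by simp
  moreover have "coprime C (e * f)"
  proof -
    have "coprime f C" using f(2) unfolding D by simp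
    thus ?thesis using e(2) by (simp add: coprime_commute)
  qed
  ultimately obtain E where E: "E > 0" "C = E\<^sup>2"
    using coprime_mult_square[of C "e * f" b] pos ef by auto
  have pE: "int p dvd E" using pC pp unfolding E(2) by (metis prime_dvd_power)
  have "p\<^sup>2 mod 4 = 1"
  proof -
    obtain q where "p = 2 * q + 1" using op by (rule oddE)
    hence "p\<^sup>2 = 4 * (q\<^sup>2 + q) + 1" by (simp add: power2_eq_square algebra_simps)
    thus ?thesis by simp
  qed
  hence t: "p\<^sup>2 = 4 * (p\<^sup>2 div 4) + 1" by (metis add.commute mult.commute div_mult_mod_eq)
  have "p\<^sup>2 \<ge> 3 * 3" unfolding power2_eq_square using p2 by (intro mult_mono) auto
  hence t1: "p\<^sup>2 div 4 \<ge> 1" by simp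
  have "pell_x (E\<^sup>2) 1 (4 * (p\<^sup>2 div 4) + 1) = B\<^sup>2"
  proof -
    have "j = (4 * (p\<^sup>2 div 4) + 1) * k" unfolding t[symmetric] jk by (simp add: power2_eq_square)
    thus ?thesis using B pell_compose(1)[OF ok(1)] C_def E(2) by metis
  qed
  from pell_x_of_square_not_square[OF p(1) p2 pE E(1) \<open>B > 0\<close> t1 this] show False .
qed

theorem fourth_powers_plus_one:
  fixes A B z :: int
  assumes "0 < A" "A < B" "(A ^ 4 + 1) * (B ^ 4 + 1) = z\<^sup>2"
  shows False
proof -
  have pos: "A\<^sup>2 > 0" "B\<^sup>2 > 0" using assms by simp_all
  have eq: "((A\<^sup>2)\<^sup>2 + 1) * ((B\<^sup>2)\<^sup>2 + 1) = z\<^sup>2" using assms(3) by simp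
  have g: "gcd (A\<^sup>2) (B\<^sup>2) = (gcd A B)\<^sup>2" by (rule gcd_exp)
  obtain i j where ij: "odd i" "odd j" "A\<^sup>2 = pell_x ((gcd A B)\<^sup>2) 1 i" "B\<^sup>2 = pell_x ((gcd A B)\<^sup>2) 1 j"
    using square_pair_param[OF pos eq] unfolding g by blast
  have gpos: "gcd A B > 0" using assms by (simp add: gcd_pos_int)
  have "j > 1"
  proof (rule ccontr)
    assume "\<not> j > 1"
    hence "j = 1" using ij(2) by (cases j) auto
    have lt: "A\<^sup>2 < B\<^sup>2" using assms by (intro power_strict_mono) auto
    have "i \<noteq> 1" using ij lt \<open>j = 1\<close> by auto
    hence "i > j" using ij(1) \<open>j = 1\<close> by (cases i) auto
    hence "B\<^sup>2 < A\<^sup>2"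
      unfolding ij(3,4) using \<open>j = 1\<close> gpos by (intro pell_x_less) auto
    thus False using lt by simp
  qed
  thus False using pell_x_square_arg_not_square[OF gpos ij(2) _ _ ij(4)[symmetric]] assms by simp
qed

section \<open>The equation \<open>b\<^sup>2\<^sup>p + 1 = 2 y\<^sup>2\<close>\<close>

text \<open>
  For odd \<open>q\<close> this is \<open>(b\<^sup>2\<^sup>q + 1) / (b\<^sup>2 + 1)\<close>.
\<close>
definition neg_geo :: "int \<Rightarrow> nat \<Rightarrow> int" where
  "neg_geo b q = (\<Sum>i<q. (- (b\<^sup>2)) ^ i)"

lemma neg_geo_add: "neg_geo b (m + n) = neg_geo b m + (- (b\<^sup>2)) ^ m * neg_geo b n"
proof (induction n)
  case (Suc n)
  have "neg_geo b (m + Suc n) = neg_geo b (m + n) + (- (b\<^sup>2)) ^ (m + n)" by (simp add: neg_geo_def)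
  also have "\<dots> = neg_geo b m + (- (b\<^sup>2)) ^ m * (neg_geo b n + (- (b\<^sup>2)) ^ n)"
    unfolding Suc by (simp add: power_add algebra_simps)
  finally show ?case by (simp add: neg_geo_def)
qed (simp add: neg_geo_def)

lemma neg_geo_mult: "(b\<^sup>2 + 1) * neg_geo b q = 1 - (- (b\<^sup>2)) ^ q"
  by (induction q) (simp_all add: neg_geo_def algebra_simps)

lemma neg_geo_mult_odd:
  assumes "odd q"
  shows "(b\<^sup>2 + 1) * neg_geo b q = b ^ (2 * q) + 1"
  unfolding neg_geo_mult using assms by (simp add: power_minus_odd power_mult)

lemma neg_geo_pos:
  assumes "odd q"
  shows "neg_geo b q > 0"
proof -
  have "b ^ (2 * q) + 1 > 0" by (simp add: add_nonneg_pos)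
  hence "(b\<^sup>2 + 1) * neg_geo b q > 0" by (simp only: neg_geo_mult_odd[OF assms])
  moreover have "b\<^sup>2 + 1 > 0" by (simp add: add_nonneg_pos)
  ultimately show ?thesis by (simp only: zero_less_mult_pos)
qed

lemma odd_square_mod_4: "odd (b :: int) \<Longrightarrow> \<exists>k. b\<^sup>2 = 4 * k + 1"
proof -
  assume "odd b"
  then obtain c where "b = 2 * c + 1" by (rule oddE)
  hence "b\<^sup>2 = 4 * (c\<^sup>2 + c) + 1" by (simp add: power2_eq_square algebra_simps)
  thus ?thesis by blast
qed

lemma neg_geo_cong_4:
  assumes "odd b" "odd q"
  shows "[neg_geo b q = 1] (mod 4)"
proof -
  have "[neg_geo b (2 * h + 1) = 1] (mod 4)" for h
  proof (induction h)
    case 0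
    show ?case by (simp add: neg_geo_def)
  next
    case (Suc h)
    obtain k where k: "b\<^sup>2 = 4 * k + 1" using odd_square_mod_4 assms(1) by blast
    have "2 * Suc h + 1 = 2 + (2 * h + 1)" by simp
    hence "neg_geo b (2 * Suc h + 1) = neg_geo b 2 + (b\<^sup>2)\<^sup>2 * neg_geo b (2 * h + 1)"
      by (simp only: neg_geo_add power2_minus)
    also have "neg_geo b 2 = 1 - b\<^sup>2" by (simp add: neg_geo_def eval_nat_numeral)
    also have "1 - b\<^sup>2 + (b\<^sup>2)\<^sup>2 * neg_geo b (2 * h + 1)
        = neg_geo b (2 * h + 1) + 4 * (- k + (4 * k\<^sup>2 + 2 * k) * neg_geo b (2 * h + 1))"
      unfolding k by (simp add: power2_eq_square algebra_simps)
    finally have e: "neg_geo b (2 * Suc h + 1)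
        = neg_geo b (2 * h + 1) + 4 * (- k + (4 * k\<^sup>2 + 2 * k) * neg_geo b (2 * h + 1))" .
    have "[neg_geo b (2 * Suc h + 1) = neg_geo b (2 * h + 1)] (mod 4)"
      unfolding cong_iff_dvd_diff e by (simp only: add_diff_cancel_left' dvd_triv_left)
    thus ?case using Suc by (rule cong_trans)
  qed
  thus ?thesis using assms(2) by (elim oddE) simp
qed

lemma neg_geo_odd:
  assumes "odd b" "odd q"
  shows "odd (neg_geo b q)"
  using neg_geo_cong_4[OF assms] unfolding cong_def by presburger

lemma coprime_neg_geo: "q > 0 \<Longrightarrow> coprime b (neg_geo b q)"
proof -
  assume "q > 0"
  then obtain m where m: "q = 1 + m" by (metis Suc_eq_plus1_left not0_implies_Suc neq0_conv)
  have "neg_geo b q = (- b * neg_geo b m) * b + 1"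
    unfolding m neg_geo_add by (simp add: neg_geo_def power2_eq_square)
  hence "gcd b (neg_geo b q) = gcd b 1" by (simp only: gcd_add_mult)
  thus ?thesis by (simp add: coprime_iff_gcd_eq_1)
qed

text \<open>
  Modulo \<open>neg_geo b l\<close>, which divides \<open>1 - (- b\<^sup>2)\<^sup>l\<close>, the sequence has period \<open>l\<close>; in the reflection the
  additional factor \<open>b\<^sup>2\<^sup>t\<close> is a square and does not affect the symbol.
\<close>
lemma jacobi_seq_neg_geo:
  assumes b: "odd b"
  shows "jacobi_seq (neg_geo b)"
  unfolding jacobi_seq_def
proof (intro conjI allI impI)
  show "neg_geo b 1 = 1" by (simp add: neg_geo_def)
next
  fix k :: nat assume "odd k"
  thus "neg_geo b k > 0" "odd (neg_geo b k)" using neg_geo_pos neg_geo_odd b by blast+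
next
  fix l r :: nat assume o: "odd l" "odd r"
  have p: "neg_geo b l > 0" "odd (neg_geo b l)" using neg_geo_pos neg_geo_odd b o by blast+
  have pow: "(- (b\<^sup>2)) ^ l = 1 - (b\<^sup>2 + 1) * neg_geo b l" using neg_geo_mult[of b l] by simp
  have sum: "neg_geo b (2 * l + r)
      = neg_geo b l + (- (b\<^sup>2)) ^ l * (neg_geo b l + (- (b\<^sup>2)) ^ l * neg_geo b r)"
    unfolding neg_geo_add[symmetric] by (simp add: mult_2 add.assoc)
  have "neg_geo b (2 * l + r) - neg_geo b r = neg_geo b l *
      (1 + (1 - (b\<^sup>2 + 1) * neg_geo b l)
        + (- 2 * (b\<^sup>2 + 1) + (b\<^sup>2 + 1)\<^sup>2 * neg_geo b l) * neg_geo b r)"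
    unfolding sum pow by (simp add: power2_eq_square algebra_simps)
  hence "[neg_geo b (2 * l + r) = neg_geo b r] (mod int (nat (neg_geo b l)))"
    using p by (simp add: cong_iff_dvd_diff)
  thus "jacobi (neg_geo b (2 * l + r)) (nat (neg_geo b l)) = jacobi (neg_geo b r) (nat (neg_geo b l))"
    by (rule jacobi_cong[rotated]) (use p in \<open>simp add: even_nat_iff\<close>)
next
  fix l t :: nat assume o: "odd l" "even t" "t < l"
  have p: "neg_geo b l > 0" "odd (neg_geo b l)" using neg_geo_pos neg_geo_odd b o by blast+
  hence on: "odd (nat (neg_geo b l))" by (simp add: even_nat_iff)
  have l: "l = t + (l - t)" using o by simp
  have e1: "neg_geo b l = neg_geo b t + (b ^ t)\<^sup>2 * neg_geo b (l - t)"
    using neg_geo_add[of b t "l - t"] l o(2) by (simp add: power_mult_distrib[symmetric] power2_eq_square)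
  have e2: "neg_geo b (l + t) = neg_geo b l + (1 - (b\<^sup>2 + 1) * neg_geo b l) * neg_geo b t"
    unfolding neg_geo_add neg_geo_mult by simp
  have "neg_geo b (l + t) - (-1 * (b ^ t)\<^sup>2) * neg_geo b (l - t)
      = neg_geo b l + (neg_geo b t + (b ^ t)\<^sup>2 * neg_geo b (l - t)) - (b\<^sup>2 + 1) * neg_geo b l * neg_geo b t"
    unfolding e2 by (simp add: algebra_simps)
  also have "\<dots> = neg_geo b l * (2 - (b\<^sup>2 + 1) * neg_geo b t)"
    unfolding e1[symmetric] by (simp add: algebra_simps)
  finally have "[neg_geo b (l + t) = (-1 * (b ^ t)\<^sup>2) * neg_geo b (l - t)] (mod int (nat (neg_geo b l)))"
    using p by (simp add: cong_iff_dvd_diff)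
  hence "jacobi (neg_geo b (l + t)) (nat (neg_geo b l))
      = jacobi ((-1 * (b ^ t)\<^sup>2) * neg_geo b (l - t)) (nat (neg_geo b l))"
    by (rule jacobi_cong[OF on])
  also have "\<dots> = jacobi (-1) (nat (neg_geo b l)) * jacobi ((b ^ t)\<^sup>2) (nat (neg_geo b l))
      * jacobi (neg_geo b (l - t)) (nat (neg_geo b l))"
    unfolding jacobi_mult_left[OF on] ..
  also have "jacobi ((b ^ t)\<^sup>2) (nat (neg_geo b l)) = 1"
  proof (rule jacobi_square[OF on])
    have "coprime b (neg_geo b l)" using coprime_neg_geo o by (simp add: odd_pos)
    thus "coprime (b ^ t) (int (nat (neg_geo b l)))" using p by simp
  qed
  finally show "jacobi (neg_geo b (l + t)) (nat (neg_geo b l))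
      = jacobi (-1) (nat (neg_geo b l)) * jacobi (neg_geo b (l - t)) (nat (neg_geo b l))" by simp
qed

text \<open>
  For odd indices the values are \<open>1\<close> modulo \<open>4\<close>, so the constant sequence \<open>1\<close> is a possible comparison.
\<close>
lemma jacobi_neg_geo:
  assumes "odd b" "odd k" "odd l" "coprime k l"
  shows "jacobi (neg_geo b k) (nat (neg_geo b l)) = 1"
proof -
  have "jacobi_seq (\<lambda>_. 1)" by (simp add: jacobi_seq_def)
  thus ?thesis
    using jacobi_seq_eq[OF jacobi_seq_neg_geo[OF assms(1)] _ neg_geo_cong_4[OF assms(1)] assms(2-4)]
    by force
qed

lemma one_minus_power: "\<exists>k. (1 - x) ^ i = 1 - int i * x + x\<^sup>2 * k" for x :: int
proof (induction i)
  case 0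
  show ?case by (intro exI[of _ 0]) simp
next
  case (Suc i)
  then obtain k where k: "(1 - x) ^ i = 1 - int i * x + x\<^sup>2 * k" by blast
  have "(1 - x) ^ Suc i = 1 - int (Suc i) * x + x\<^sup>2 * (int i + k - x * k)"
    unfolding power_Suc k by (simp add: power2_eq_square algebra_simps)
  thus ?case by blast
qed

lemma neg_geo_expand:
  "\<exists>k. neg_geo b n = int n - (b\<^sup>2 + 1) * (\<Sum>i<n. int i) + (b\<^sup>2 + 1)\<^sup>2 * k"
proof -
  have "\<exists>k. (- (b\<^sup>2)) ^ i = 1 - int i * (b\<^sup>2 + 1) + (b\<^sup>2 + 1)\<^sup>2 * k" for i
    using one_minus_power[of "b\<^sup>2 + 1" i] by simp
  then obtain k where k: "\<And>i. (- (b\<^sup>2)) ^ i = 1 - int i * (b\<^sup>2 + 1) + (b\<^sup>2 + 1)\<^sup>2 * k i" by metis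
  have "neg_geo b n = int n - (b\<^sup>2 + 1) * (\<Sum>i<n. int i) + (b\<^sup>2 + 1)\<^sup>2 * (\<Sum>i<n. k i)"
    unfolding neg_geo_def k sum.distrib sum_subtractf sum_distrib_left sum_distrib_right
    by (simp add: mult.commute)
  thus ?thesis by blast
qed

text \<open>
  The linear term \<open>(b\<^sup>2 + 1) p (p - 1) / 2\<close> of the expansion in powers of \<open>b\<^sup>2 + 1\<close> carries a further factor \<open>p\<close>, as \<open>p\<close> is odd.
\<close>
lemma neg_geo_prime_dvd:
  fixes p :: nat
  assumes "odd p" "int p dvd b\<^sup>2 + 1"
  shows "\<exists>e. neg_geo b p = int p * e \<and> coprime e (b\<^sup>2 + 1)"
proof -
  obtain k where k: "neg_geo b p = int p - (b\<^sup>2 + 1) * (\<Sum>i<p. int i) + (b\<^sup>2 + 1)\<^sup>2 * k"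
    using neg_geo_expand by blast
  obtain m where m: "b\<^sup>2 + 1 = int p * m" using assms(2) by blast
  obtain h where h: "p = 2 * h + 1" using assms(1) by (rule oddE)
  have gauss: "(\<Sum>i<2 * n + 1. int i) = int (2 * n + 1) * int n" for n
    by (induction n) (simp_all add: algebra_simps)
  have "neg_geo b p = int p * (1 + (m * k - int h) * (b\<^sup>2 + 1))"
    unfolding k gauss[of h, folded h] unfolding m by (simp add: power2_eq_square algebra_simps)
  moreover have "coprime (1 + (m * k - int h) * (b\<^sup>2 + 1)) (b\<^sup>2 + 1)"
    by (metis coprime_1_left coprime_iff_gcd_eq_1 gcd.commute gcd_add_mult add.commute)
  ultimately show ?thesis by blast
qed

text \<open>
  Modulo \<open>q\<close> the value is \<open>j\<close>, and dividing the index by \<open>q\<close> removes exactly one factor \<open>q\<close> from the value.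
\<close>
lemma prime_power_dvd_pell_w:
  fixes q :: nat
  assumes q: "prime q" "odd q" "int q dvd b" and "b > 0" and "odd j" "int q ^ n dvd pell_w b j"
  shows "q ^ n dvd j"
  using assms(5,6)
proof (induction j arbitrary: n rule: less_induct)
  case (less j)
  show ?case
  proof (cases n)
    case (Suc n')
    have pq: "prime (int q)" using q(1) by simp
    have "int q dvd pell_w b j - int j"
      using pell_w_cong[OF less.prems(1), of b] q(3) by (metis dvd_mult dvd_trans power2_eq_square)
    moreover have "int q dvd pell_w b j" using less.prems(2) unfolding Suc by (metis dvd_mult_left power_Suc)
    ultimately have "int q dvd int j" using dvd_diff_right_iff by blast
    then obtain i where i: "j = q * i" by auto
    have oi: "odd i" "i < j" using less.prems(1) prime_gt_1_nat[OF q(1)] unfolding i by (auto simp: odd_pos)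
    define C where "C = pell_x b 1 i"
    have C: "C = b * pell_w b i" unfolding C_def by (rule pell_x_eq_w[OF oi(1)])
    obtain e where e: "pell_w C q = int q * e" "coprime e C"
      using pell_w_prime_part[OF q(2), of C] q(3) unfolding C by auto
    have "coprime (int q) e"
      using e(2) q(3) unfolding C by (metis coprime_commute coprime_mult_right_iff coprime_divisors dvd_refl)
    hence cop: "coprime (int q ^ n') e" by simp
      have "b * pell_w b j = b * (pell_w b i * (int q * e))"
        unfolding pell_x_eq_w[OF less.prems(1), symmetric] unfolding i pell_compose(1)[OF oi(1)]
          C_def[symmetric] pell_x_eq_w[OF q(2)] e(1) by (simp add: C mult_ac)
      hence "pell_w b j = int q * (pell_w b i * e)" using \<open>b > 0\<close> by simp
      hence "int q * int q ^ n' dvd int q * (pell_w b i * e)" using less.prems(2) unfolding Suc by simp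
      hence "int q ^ n' dvd pell_w b i * e" using prime_gt_0_nat[OF q(1)] by simp
      hence "int q ^ n' dvd pell_w b i" using cop by (simp add: coprime_dvd_mult_left_iff)
      hence "q ^ n' dvd i" using less.IH[OF oi(2,1)] by blast
      thus ?thesis unfolding i Suc by simp
  qed simp
qed

text \<open>
  The factors of \<open>b\<^sup>2\<^sup>p + 1 = (b\<^sup>2 + 1) E\<^sub>p\<close> have no common prime except possibly \<open>p\<close>. If \<open>p\<close> does not divide \<open>b\<^sup>2 + 1\<close>,
  then \<open>E\<^sub>p\<close> is a square and \<open>(b, b\<^sup>p)\<close> is a pair to which \<open>square_pair_param\<close> applies. Otherwise
  \<open>E\<^sub>p\<close> is \<open>p\<close> times a square, and a nonresidue \<open>l\<close> of \<open>p\<close> gives a contradiction through the symbol of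
  \<open>E\<^sub>p\<close> over \<open>E\<^sub>l\<close>.
\<close>
theorem power_plus_one_double_square:
  fixes b y :: int and p :: nat
  assumes b: "b > 1" and p: "prime p" "odd p" and eq: "b ^ (2 * p) + 1 = 2 * y\<^sup>2"
  shows False
proof -
  have ob: "odd b"
  proof
    assume "even b"
    hence "even (b ^ (2 * p))" using prime_gt_0_nat[OF p(1)] by simp
    moreover have "even (b ^ (2 * p) + 1)" unfolding eq by simp
    ultimately show False by simp
  qed
  define x where "x = (b\<^sup>2 + 1) div 2"
  have "even (b\<^sup>2 + 1)" using ob by simp
  hence x: "b\<^sup>2 + 1 = 2 * x" unfolding x_def by (rule dvd_mult_div_cancel[symmetric])
  have xpos: "x > 0" using x zero_le_power2[of b] by linarith
  have Epos: "neg_geo b p > 0" by (rule neg_geo_pos[OF p(2)])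
  have xE: "x * neg_geo b p = y\<^sup>2" using neg_geo_mult_odd[OF p(2), of b] eq x by simp
  show False
  proof (cases "int p dvd b\<^sup>2 + 1")
    case False
    obtain k where k: "neg_geo b p = int p - (b\<^sup>2 + 1) * (\<Sum>i<p. int i) + (b\<^sup>2 + 1)\<^sup>2 * k"
      using neg_geo_expand by blast
    have "neg_geo b p = (- (\<Sum>i<p. int i) + (b\<^sup>2 + 1) * k) * (b\<^sup>2 + 1) + int p"
      unfolding k by (simp add: power2_eq_square algebra_simps)
    hence "gcd (b\<^sup>2 + 1) (neg_geo b p) = gcd (b\<^sup>2 + 1) (int p)" by (simp only: gcd_add_mult)
    moreover have "coprime (int p) (b\<^sup>2 + 1)" using p(1) False by (simp add: prime_imp_coprime)
    ultimately have "coprime (b\<^sup>2 + 1) (neg_geo b p)" by (simp add: coprime_iff_gcd_eq_1 gcd.commute)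
    hence "coprime (neg_geo b p) x" unfolding x by (simp add: coprime_commute)
    then obtain t where t: "neg_geo b p = t\<^sup>2"
      using coprime_mult_square[of "neg_geo b p" x y] xE Epos xpos by (auto simp: mult.commute)
    have "(b\<^sup>2 + 1) * ((b ^ p)\<^sup>2 + 1) = ((b\<^sup>2 + 1) * t)\<^sup>2"
    proof -
      have "(b ^ p)\<^sup>2 + 1 = (b\<^sup>2 + 1) * t\<^sup>2"
        using neg_geo_mult_odd[OF p(2), of b] unfolding t by (simp add: power_mult[symmetric] mult.commute)
      thus ?thesis by (simp add: power2_eq_square)
    qed
    then obtain j where j: "odd j" "b ^ p = pell_x (gcd b (b ^ p)) 1 j"
      using square_pair_param[of b "b ^ p"] b by auto
    have "b dvd b ^ p" using prime_gt_0_nat[OF p(1)] by (simp add: dvd_power)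
    hence "gcd b (b ^ p) = b" using b by (simp add: gcd_proj1_iff)
    hence j': "b ^ p = pell_x b 1 j" using j(2) by simp
    have "j < p"
    proof (rule ccontr)
      assume "\<not> j < p"
      hence jp: "j \<ge> p" "j > 1" "j > 0" using prime_gt_1_nat[OF p(1)] by simp_all
      have "b ^ p \<le> b ^ j" using b jp by (intro power_increasing) auto
      moreover have "1 * b ^ j < 2 ^ (j - 1) * b ^ j"
        using b jp by (intro mult_strict_right_mono one_less_power) auto
      moreover have "2 ^ (j - 1) * b ^ j \<le> b ^ p"
        unfolding j' using b jp by (intro pell_x_ge_power) auto
      ultimately show False by linarith
    qed
    have "nat b \<noteq> 1" using b by simp
    then obtain r where "prime r" "r dvd nat b" using prime_factor_nat by blast
    moreover from this(2) have "int r dvd int (nat b)" by (simp only: int_dvd_int_iff)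
    ultimately have r: "prime r" "int r dvd b" using b by simp_all
    have "odd r" using r(2) ob by (metis dvd_trans even_of_nat)
    have "b * pell_w b j = b ^ p" unfolding j' by (rule pell_x_eq_w[OF j(1), symmetric])
    also have "\<dots> = b * b ^ (p - 1)"
      using power_minus_mult[OF prime_gt_0_nat[OF p(1)], of b] by (simp only: mult.commute)
    finally have "pell_w b j = b ^ (p - 1)" using b by simp
    hence "int r ^ (p - 1) dvd pell_w b j" using r(2) by (simp add: dvd_power_same)
    hence "r ^ (p - 1) dvd j" using prime_power_dvd_pell_w[OF r(1) \<open>odd r\<close> r(2) _ j(1)] b by simp
    hence "r ^ (p - 1) \<le> j" using j(1) by (intro dvd_imp_le) (auto simp: odd_pos)
    moreover have "2 ^ (p - 1) \<le> r ^ (p - 1)" using prime_ge_2_nat[OF r(1)] by (intro power_mono) auto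
    moreover have "p - 1 < 2 ^ (p - 1)" by (rule less_exp)
    ultimately show False using \<open>j < p\<close> by linarith
  next
    case True
    obtain e where e: "neg_geo b p = int p * e" "coprime e (b\<^sup>2 + 1)"
      using neg_geo_prime_dvd[OF p(2) True] by blast
    have ppos: "int p > 0" using prime_gt_0_nat[OF p(1)] by simp
    have epos: "e > 0" using Epos ppos unfolding e(1) by (simp add: zero_less_mult_iff)
    have "coprime e x" using e(2) unfolding x by simp
    moreover have "coprime e (int p)" using e(2) True by (metis coprime_divisors dvd_refl)
    ultimately have "coprime e (x * int p)" by simp
    moreover have "e * (x * int p) = y\<^sup>2" using xE unfolding e(1) by (simp add: mult_ac)
    ultimately obtain t where t: "e = t\<^sup>2"
      using coprime_mult_square[of e "x * int p" y] epos xpos ppos by auto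
    obtain a where a: "Legendre (int a) (int p) = -1" using prime_nonresidue[OF p] by blast
    define l where "l = (if odd a then a else a + p)"
    have ol: "odd l" using p(2) by (simp add: l_def)
    have "Legendre (int l) (int p) = -1"
      using a Legendre_cong[of "int l" "int a" "int p"] by (auto simp: l_def cong_def)
    hence lp: "jacobi (int l) p = -1" using jacobi_prime p(1) by simp
    hence "coprime p l" using jacobi_eq_0[OF p(2), of "int l"] by (auto simp: coprime_commute)
    have El: "neg_geo b l > 0" "odd (nat (neg_geo b l))" "int (nat (neg_geo b l)) = neg_geo b l"
      using jacobi_seq_pos[OF jacobi_seq_neg_geo[OF ob] ol] by blast+
    have "1 = jacobi (int p * (t * t)) (nat (neg_geo b l))"
      using jacobi_neg_geo[OF ob p(2) ol \<open>coprime p l\<close>] unfolding e(1) t power2_eq_square by simp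
    also have "\<dots> = jacobi (int p) (nat (neg_geo b l)) * (jacobi t (nat (neg_geo b l)) * jacobi t (nat (neg_geo b l)))"
      unfolding jacobi_mult_left[OF El(2)] ..
    finally have "jacobi (int p) (nat (neg_geo b l)) = 1"
      using jacobi_range[OF El(2), of "int p"] jacobi_range[OF El(2), of t] by auto
    moreover have "jacobi (int p) (nat (neg_geo b l)) = jacobi (neg_geo b l) p"
    proof -
      have "int (nat (neg_geo b l) mod 4) = 1"
        using neg_geo_cong_4[OF ob ol] El(3) by (simp add: zmod_int cong_def)
      hence "recip_sign p (nat (neg_geo b l)) = 1" by (simp add: recip_sign_def)
      thus ?thesis using jacobi_reciprocity[OF p(2) El(2)] El(3) by simp
    qed
    moreover have "jacobi (neg_geo b l) p = jacobi (int l) p"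
    proof (rule jacobi_cong[OF p(2)])
      obtain k where k: "neg_geo b l = int l - (b\<^sup>2 + 1) * (\<Sum>i<l. int i) + (b\<^sup>2 + 1)\<^sup>2 * k"
        using neg_geo_expand by blast
      have "neg_geo b l - int l = (b\<^sup>2 + 1) * ((b\<^sup>2 + 1) * k - (\<Sum>i<l. int i))"
        unfolding k by (simp add: power2_eq_square algebra_simps)
      thus "[neg_geo b l = int l] (mod int p)" using True by (simp add: cong_iff_dvd_diff)
    qed
    ultimately show False using lp by simp
  qed
qed

section \<open>Even exponents\<close>

lemma pell_u_eq_pell_x: "int (pell_u (Suc r)) = pell_x 1 1 (2 * r + 1)
    \<and> int (pell_v (Suc r)) = pell_y 1 1 (2 * r + 1)"
proof (induction r)
  case 0
  show ?case using neg_pell_1 by simp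
next
  case (Suc r)
  thus ?case using neg_pell_Suc[of "Suc r"] by simp
qed

lemma pell_x_gt_square:
  fixes c :: int
  assumes "c > 0" "odd i" "i \<noteq> 1"
  shows "c\<^sup>2 < pell_x c 1 i"
proof -
  have "i \<ge> 3" using assms(2,3) by (cases i rule: nat.exhaust) presburger+
  have "c\<^sup>2 * 1 < pell_x c 1 2" using assms(1) by (simp add: eval_nat_numeral)
  also have "pell_x c 1 2 < pell_x c 1 i" using assms(1) \<open>i \<ge> 3\<close> by (intro pell_x_less) auto
  finally show ?thesis by simp
qed

lemma odd_gt_1_prime_mult:
  assumes "odd (m :: nat)" "m \<noteq> 1"
  shows "\<exists>p k. prime p \<and> odd p \<and> m = k * p"
proof -
  obtain p where p: "prime p" "p dvd m" using prime_factor_nat assms(2) by blast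
  then obtain k where "m = k * p" by (metis dvd_div_mult_self)
  thus ?thesis using p assms(1) by auto
qed


theorem theorem1p2:
  fixes a b g n x :: nat
  assumes "a > 0" and "b > 0" and "g = gcd a b"
    and "a < b"
    and "n > 0" and "x > 0" and "even n"
    and "(a ^ n + 1) * (b ^ n + 1) = x\<^sup>2"
  shows "(g = 1 \<longrightarrow>
            n = 2 \<and>
            (\<exists>r s :: nat. r > 0 \<and> s > 0 \<and>
               (a, b, x) = (pell_u r, pell_u s, 2 * pell_v r * pell_v s) \<and>
               r < s \<and> gcd (2 * r - 1) (2 * s - 1) = 1)) \<and>
         (1 < g \<and> g < a \<longrightarrow> \<not> 4 dvd n \<and> g\<^sup>2 < a) \<and>
         (g = a \<longrightarrow> \<not> 4 dvd n \<and> a\<^sup>2 < b)"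
proof -
  from \<open>even n\<close> obtain m where n: "n = 2 * m" by blast
  have m: "m > 0" using \<open>n > 0\<close> n by simp
  define A B where "A = int (a ^ m)" and "B = int (b ^ m)"
  have AB: "0 < A" "A < B"
    unfolding A_def B_def using \<open>a > 0\<close> \<open>a < b\<close> m by (simp_all add: power_strict_mono)
  have eq: "(A\<^sup>2 + 1) * (B\<^sup>2 + 1) = (int x)\<^sup>2"
  proof -
    have "int ((a ^ n + 1) * (b ^ n + 1)) = int (x\<^sup>2)" using assms(8) by (simp only:)
    thus ?thesis unfolding n power_even_eq A_def B_def
      by (simp only: of_nat_mult of_nat_add of_nat_power of_nat_1)
  qed
  have gcdAB: "gcd A B = int (g ^ m)"
    unfolding A_def B_def \<open>g = gcd a b\<close> by (simp add: gcd_int_int_eq del: of_nat_power)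
  have g: "g > 0" using \<open>a > 0\<close> \<open>g = gcd a b\<close> by simp
  hence gm: "int (g ^ m) > 0" by simp
  obtain i j where ij: "odd i" "odd j" "coprime i j"
    "A = pell_x (int (g ^ m)) 1 i" "B = pell_x (int (g ^ m)) 1 j"
    using square_pair_param[of A B "int x"] AB eq unfolding gcdAB by auto
  have "odd m"
  proof
    assume "even m"
    then obtain k where k: "m = 2 * k" by blast
    have "int (a ^ k) < int (b ^ k)"
      using \<open>a < b\<close> m k by (simp add: power_strict_mono)
    moreover have "A\<^sup>2 = int (a ^ k) ^ 4" "B\<^sup>2 = int (b ^ k) ^ 4"
      unfolding A_def B_def k by (simp_all flip: power_mult add: mult.commute)
    ultimately show False
      using fourth_powers_plus_one[of "int (a ^ k)" "int (b ^ k)" "int x"] eq \<open>a > 0\<close> by simp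
  qed
  hence n4: "\<not> 4 dvd n" unfolding n by presburger
  have "i < j"
  proof (rule ccontr)
    assume "\<not> i < j"
    hence "B \<le> A"
      unfolding ij(4,5) using pell_x_less[OF gm, of j i] ij(2) by (cases "i = j") (auto simp: odd_pos)
    thus False using AB by simp
  qed
  have square_less: "g\<^sup>2 < c" if "int (c ^ m) = pell_x (int (g ^ m)) 1 k" "odd k" "k \<noteq> 1" for c k
  proof -
    have "(int (g ^ m))\<^sup>2 < int (c ^ m)" using pell_x_gt_square[OF gm that(2,3)] that(1) by simp
    hence "int ((g\<^sup>2) ^ m) < int (c ^ m)" by (simp flip: power_mult add: mult.commute)
    hence "(g\<^sup>2) ^ m < c ^ m" by (simp only: of_nat_less_iff)
    thus ?thesis by (rule power_less_imp_less_base) simp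
  qed
  show ?thesis
  proof (intro conjI impI)
    assume "g = 1"
    hence ij1: "A = pell_x 1 1 i" "B = pell_x 1 1 j" using ij by simp_all
    have "m = 1"
    proof (rule ccontr)
      assume "m \<noteq> 1"
      then obtain p k where p: "prime p" "odd p" "m = k * p"
        using odd_gt_1_prime_mult \<open>odd m\<close> by blast
      have "k > 0" using m p(3) by simp
      have "b ^ k > 1" using \<open>a > 0\<close> \<open>a < b\<close> \<open>k > 0\<close> by (intro one_less_power) auto
      hence bk: "int (b ^ k) > 1" by linarith
      have "B\<^sup>2 + 1 = 2 * (pell_y 1 1 j)\<^sup>2"
        using pell_norm_odd[OF ij(2), of "1 :: int"] unfolding ij1(2) by simp
      moreover have "B\<^sup>2 = int (b ^ k) ^ (2 * p)"
        unfolding B_def p(3) by (simp flip: power_mult add: mult_ac)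
      ultimately have "int (b ^ k) ^ (2 * p) + 1 = 2 * (pell_y 1 1 j)\<^sup>2" by (simp only:)
      thus False by (rule power_plus_one_double_square[OF bk p(1,2)])
    qed
    thus n2: "n = 2" using n by simp
    obtain r s where rs: "i = 2 * r + 1" "j = 2 * s + 1" using ij(1,2) by (metis oddE)
    have ab: "int a = int (pell_u (Suc r))" "int b = int (pell_u (Suc s))"
      using ij1 pell_u_eq_pell_x[of r] pell_u_eq_pell_x[of s] \<open>m = 1\<close>
      unfolding rs A_def B_def by simp_all
    have "int x = int (2 * pell_v (Suc r) * pell_v (Suc s))"
    proof -
      have "A\<^sup>2 + 1 = 2 * (int (pell_v (Suc r)))\<^sup>2" "B\<^sup>2 + 1 = 2 * (int (pell_v (Suc s)))\<^sup>2"
        using pell_norm_odd[OF ij(1), of "1 :: int"] pell_norm_odd[OF ij(2), of "1 :: int"]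
          pell_u_eq_pell_x[of r] pell_u_eq_pell_x[of s]
        unfolding ij1 rs by simp_all
      hence "(int x)\<^sup>2 = (int (2 * pell_v (Suc r) * pell_v (Suc s)))\<^sup>2"
        unfolding eq[symmetric] by (simp add: power_mult_distrib)
      thus ?thesis by (rule power2_eq_imp_eq) simp_all
    qed
    hence x: "x = 2 * pell_v (Suc r) * pell_v (Suc s)" by (simp only: of_nat_eq_iff)
    have "a = pell_u (Suc r)" "b = pell_u (Suc s)" using ab by (simp_all only: of_nat_eq_iff)
    hence abx: "(a, b, x) = (pell_u (Suc r), pell_u (Suc s), 2 * pell_v (Suc r) * pell_v (Suc s))"
      unfolding x by (simp only:)
    have idx: "2 * Suc r - 1 = i" "2 * Suc s - 1 = j" unfolding rs by simp_all
    have "gcd (2 * Suc r - 1) (2 * Suc s - 1) = 1"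
      unfolding idx using ij(3) by (simp only: coprime_iff_gcd_eq_1)
    moreover have "Suc r < Suc s" using \<open>i < j\<close> rs by simp
    ultimately show "\<exists>r s. r > 0 \<and> s > 0 \<and>
        (a, b, x) = (pell_u r, pell_u s, 2 * pell_v r * pell_v s) \<and>
        r < s \<and> gcd (2 * r - 1) (2 * s - 1) = 1"
      by (intro exI[of _ "Suc r"] exI[of _ "Suc s"] conjI abx zero_less_Suc)
  next
    assume "1 < g \<and> g < a"
    show "\<not> 4 dvd n" by (rule n4)
    have "i \<noteq> 1"
    proof
      assume "i = 1"
      hence "int (a ^ m) = int (g ^ m)" using ij(4) unfolding A_def by simp
      hence "a ^ m = g ^ m" by (simp only: of_nat_eq_iff)
      hence "a = g" using m by (simp add: power_eq_iff_eq_base)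
      thus False using \<open>1 < g \<and> g < a\<close> by simp
    qed
    thus "g\<^sup>2 < a" using square_less ij unfolding A_def by blast
  next
    assume "g = a"
    show "\<not> 4 dvd n" by (rule n4)
    have "j \<noteq> 1" using \<open>i < j\<close> ij(1) by (cases i) auto
    thus "a\<^sup>2 < b" using square_less ij \<open>g = a\<close> unfolding B_def by blast
  qed
qed

end
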